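(* The assignment $D \mapsto \mathcal{M} D$ is the object part of a commutative (strong) monad on $\mathbf{DCPO}$, whose unit, Kleisli extension and strength are the (co)restrictions of those of $\mathcal{V}$. Precisely: for every dcpo $D$, the map $\eta_D\colon D\to \mathcal{M} D$, $x\mapsto \delta_x$ is well defined and Scott-continuous; for every Scott-continuous $f\colon D\to \mathcal{M} E$, the map $f^{\dagger}\colon \nu\mapsto \lambda U\in\sigma E.\ \int_{x\in D} f(x)(U)\,d\nu$ maps $\mathcal{M} D$ into $\mathcal{M} E$; for all dcpo's $D,E$ the map $\tau_{D,E}\colon D\times \mathcal{M} E\to \mathcal{M}(D\times E)$, $(a,\nu)\mapsto \lambda U\in\sigma(D\times E).\ \int_{y\in E}\chi_U(a,y)\,d\nu$ is well defined; these data form a strong monad on $\mathbf{DCPO}$, and this monad is commutative, i.e. for all dcpo's $D,E$, all $U\in\sigma(D\times E)$, and all $\nu\in\mathcal{M} D$, $\xi\in\mathcal{M} E$, $$\int_{x\in D}\int_{y\in E}\chi_U(x,y)\,d\xi\,d\nu=\int_{y\in E}\int_{x\in D}\chi_U(x,y)\,d\nu\,d\xi .$$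
   Context: $\mathbf{DCPO}$ is the category of directed-complete partial orders (dcpo's) and Scott-continuous maps. For a dcpo $D$, $\sigma D$ is its Scott topology; $D\times E$ carries the product order and $\sigma(D\times E)$ is the Scott topology of that dcpo (not the product topology). A subprobability valuation on a topological space $X$ with open sets $\mathcal O X$ is a Scott-continuous map $\nu\colon\mathcal O X\to[0,1]$ with $\nu(\emptyset)=0$ and $\nu(U)+\nu(V)=\nu(U\cup V)+\nu(U\cap V)$. $\mathcal{V} D$ denotes the set of subprobability valuations on $(D,\sigma D)$, ordered pointwise (stochastic order); it is a dcpo with pointwise directed suprema. $\delta_x$ is the Dirac valuation ($\delta_x(U)=1$ iff $x\in U$, else $0$). A simple valuation is $\sum_{i=1}^n r_i\delta_{x_i}$ with $r_i>0$, $\sum r_i\le 1$; $\mathcal{S} D$ is the set of simple valuations. A sub-dcpo of a dcpo is a subset closed under suprema of directed subsets. $\mathcal{M} D$ is the intersection of all sub-dcpo's of $\mathcal{V} D$ containing $\mathcal{S} D$, with the stochastic order. For a Scott-continuous $f\colon D\to[0,1]$ and $\nu\in\mathcal{V} D$, $\int_{x\in D} f(x)\,d\nu:=\int_0^1\nu(f^{-1}((t,1]))\,dt$ (a Riemann integral), where $[0,1]$ has the Scott topology; $\chi_U$ is the characteristic function of $U$. *)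

theory Defs
  imports "HOL-Analysis.Analysis" "HOL-Algebra.Order"
begin

section \<open>Dcpos and Scott-continuous maps\<close>

definition directed :: "'a gorder \<Rightarrow> 'a set \<Rightarrow> bool" where
  "directed D A \<longleftrightarrow> A \<subseteq> carrier D \<and> A \<noteq> {} \<and>
     (\<forall>x\<in>A. \<forall>y\<in>A. \<exists>z\<in>A. x \<sqsubseteq>\<^bsub>D\<^esub> z \<and> y \<sqsubseteq>\<^bsub>D\<^esub> z)"

definition is_lub :: "'a gorder \<Rightarrow> 'a set \<Rightarrow> 'a \<Rightarrow> bool" where
  "is_lub D A s \<longleftrightarrow> least D s (Upper D A)"

definition dcpo :: "'a gorder \<Rightarrow> bool" where
  "dcpo D \<longleftrightarrow> partial_order D \<and> (\<forall>A. directed D A \<longrightarrow> (\<exists>s. is_lub D A s))"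

definition sub_dcpo :: "'a gorder \<Rightarrow> 'a set \<Rightarrow> bool" where
  "sub_dcpo D S \<longleftrightarrow> S \<subseteq> carrier D \<and>
     (\<forall>A s. A \<subseteq> S \<and> directed D A \<and> is_lub D A s \<longrightarrow> s \<in> S)"

definition scott_continuous :: "'a gorder \<Rightarrow> 'b gorder \<Rightarrow> ('a \<Rightarrow> 'b) \<Rightarrow> bool" where
  "scott_continuous D E f \<longleftrightarrow>
     f \<in> carrier D \<rightarrow> carrier E \<and>
     (\<forall>x\<in>carrier D. \<forall>y\<in>carrier D. x \<sqsubseteq>\<^bsub>D\<^esub> y \<longrightarrow> f x \<sqsubseteq>\<^bsub>E\<^esub> f y) \<and>
     (\<forall>A s. directed D A \<and> is_lub D A s \<longrightarrow> is_lub E (f ` A) (f s))"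

definition scott_open :: "'a gorder \<Rightarrow> 'a set \<Rightarrow> bool" where
  "scott_open D U \<longleftrightarrow> U \<subseteq> carrier D \<and>
     (\<forall>x\<in>U. \<forall>y\<in>carrier D. x \<sqsubseteq>\<^bsub>D\<^esub> y \<longrightarrow> y \<in> U) \<and>
     (\<forall>A s. directed D A \<and> is_lub D A s \<and> s \<in> U \<longrightarrow> A \<inter> U \<noteq> {})"

definition scott_topology :: "'a gorder \<Rightarrow> 'a topology" where
  "scott_topology D = topology (scott_open D)"

lemma istopology_scott_open: "istopology (scott_open D)"
  unfolding istopology_def
proof (intro conjI allI impI)
  fix S T assume S: "scott_open D S" and T: "scott_open D T"
  show "scott_open D (S \<inter> T)"
    unfolding scott_open_def
  proof (intro conjI allI impI)
    fix A s assume A: "directed D A \<and> is_lub D A s \<and> s \<in> S \<inter> T"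
    then obtain a b where ab: "a \<in> A" "a \<in> S" "b \<in> A" "b \<in> T"
      using S T unfolding scott_open_def by blast
    then obtain c where c: "c \<in> A" "a \<sqsubseteq>\<^bsub>D\<^esub> c" "b \<sqsubseteq>\<^bsub>D\<^esub> c" "c \<in> carrier D"
      using A unfolding directed_def by blast
    then have "c \<in> S \<inter> T"
      using S T ab unfolding scott_open_def by blast
    with c show "A \<inter> (S \<inter> T) \<noteq> {}" by blast
  qed (use S T in \<open>auto simp: scott_open_def\<close>)
next
  fix \<K> assume K: "\<forall>K\<in>\<K>. scott_open D K"
  show "scott_open D (\<Union>\<K>)"
    unfolding scott_open_def
  proof (intro conjI allI impI ballI)
    show "\<Union>\<K> \<subseteq> carrier D"
      using K unfolding scott_open_def by blast
  next
    fix x y assume x: "x \<in> \<Union>\<K>" and y: "y \<in> carrier D" "x \<sqsubseteq>\<^bsub>D\<^esub> y"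
    from x obtain K' where K': "K' \<in> \<K>" "x \<in> K'" by blast
    with K have "scott_open D K'" by blast
    with K' y have "y \<in> K'" unfolding scott_open_def by blast
    with K' show "y \<in> \<Union>\<K>" by blast
  next
    fix A s assume A: "directed D A \<and> is_lub D A s \<and> s \<in> \<Union>\<K>"
    then obtain K' where K': "K' \<in> \<K>" "s \<in> K'" by blast
    with K have "scott_open D K'" by blast
    with K' A have "A \<inter> K' \<noteq> {}" unfolding scott_open_def by blast
    with K' show "A \<inter> \<Union>\<K> \<noteq> {}" by blast
  qed
qed

lemma openin_scott_topology [simp]: "openin (scott_topology D) = scott_open D"
  unfolding scott_topology_def by (rule topology_inverse'[OF istopology_scott_open])

lemma topspace_scott_topology [simp]: "topspace (scott_topology D) = carrier D"
proof
  show "topspace (scott_topology D) \<subseteq> carrier D"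
    unfolding topspace_def by (auto simp: scott_open_def)
  have "scott_open D (carrier D)"
    unfolding scott_open_def directed_def by auto
  then show "carrier D \<subseteq> topspace (scott_topology D)"
    using openin_subset[of "scott_topology D"] by simp
qed

definition prod_order :: "'a gorder \<Rightarrow> 'b gorder \<Rightarrow> ('a \<times> 'b) gorder"  (infixr \<open>\<times>\<^sub>D\<close> 75) where
  "D \<times>\<^sub>D E = \<lparr>carrier = carrier D \<times> carrier E, eq = (=),
     le = (\<lambda>p q. fst p \<sqsubseteq>\<^bsub>D\<^esub> fst q \<and> snd p \<sqsubseteq>\<^bsub>E\<^esub> snd q)\<rparr>"

definition one_order :: "unit gorder" where
  "one_order = \<lparr>carrier = {()}, eq = (=), le = (=)\<rparr>"

definition unit_interval_order :: "real gorder" where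
  "unit_interval_order = \<lparr>carrier = {0..1}, eq = (=), le = (\<le>)\<rparr>"

definition opens_order :: "'a topology \<Rightarrow> 'a set gorder" where
  "opens_order X = \<lparr>carrier = {U. openin X U}, eq = (=), le = (\<subseteq>)\<rparr>"

section \<open>Valuations\<close>

text \<open>Valuations on \<open>X\<close> are functions on the open sets only; as HOL functions they are made
  extensional, so that equality of valuations is equality on all open sets.\<close>

definition subprob_valuation :: "'a topology \<Rightarrow> ('a set \<Rightarrow> real) \<Rightarrow> bool" where
  "subprob_valuation X \<nu> \<longleftrightarrow>
     \<nu> \<in> extensional {U. openin X U} \<and>
     scott_continuous (opens_order X) unit_interval_order \<nu> \<and>
     \<nu> {} = 0 \<and>
     (\<forall>U V. openin X U \<and> openin X V \<longrightarrow> \<nu> U + \<nu> V = \<nu> (U \<union> V) + \<nu> (U \<inter> V))"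

definition \<V> :: "'a gorder \<Rightarrow> ('a set \<Rightarrow> real) gorder" where
  "\<V> D = \<lparr>carrier = {\<nu>. subprob_valuation (scott_topology D) \<nu>}, eq = (=),
     le = (\<lambda>\<nu> \<xi>. \<forall>U. openin (scott_topology D) U \<longrightarrow> \<nu> U \<le> \<xi> U)\<rparr>"

definition dirac :: "'a gorder \<Rightarrow> 'a \<Rightarrow> 'a set \<Rightarrow> real" where
  "dirac D x = (\<lambda>U\<in>{U. openin (scott_topology D) U}. if x \<in> U then 1 else 0)"

definition \<S> :: "'a gorder \<Rightarrow> ('a set \<Rightarrow> real) set" where
  "\<S> D = {(\<lambda>U\<in>{U. openin (scott_topology D) U}. \<Sum>i=1..n. r i * dirac D (x i) U) |
     (n::nat) (r :: nat \<Rightarrow> real) (x :: nat \<Rightarrow> 'a).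
       (\<forall>i\<in>{1..n}. r i > 0 \<and> x i \<in> carrier D) \<and> (\<Sum>i=1..n. r i) \<le> 1}"

definition \<M> :: "'a gorder \<Rightarrow> ('a set \<Rightarrow> real) gorder" where
  "\<M> D = (\<V> D)\<lparr>carrier := \<Inter>{S. sub_dcpo (\<V> D) S \<and> \<S> D \<subseteq> S}\<rparr>"

text \<open>For Scott-continuous \<open>f\<close> the integrand below is antitone in \<open>t\<close>, hence Riemann integrable,
  and the Henstock-Kurzweil integral of the library is its Riemann integral.\<close>

definition vintegral :: "'a gorder \<Rightarrow> ('a set \<Rightarrow> real) \<Rightarrow> ('a \<Rightarrow> real) \<Rightarrow> real" where
  "vintegral D \<nu> f = integral {0..1} (\<lambda>t. \<nu> (f -` {t<..1} \<inter> carrier D))"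

section \<open>The structure maps\<close>

definition kleisli ::
  "'a gorder \<Rightarrow> 'b gorder \<Rightarrow> ('a \<Rightarrow> 'b set \<Rightarrow> real) \<Rightarrow> ('a set \<Rightarrow> real) \<Rightarrow> 'b set \<Rightarrow> real" where
  "kleisli D E f \<nu> = (\<lambda>U\<in>{U. openin (scott_topology E) U}. vintegral D \<nu> (\<lambda>x. f x U))"

definition strength ::
  "'a gorder \<Rightarrow> 'b gorder \<Rightarrow> 'a \<times> ('b set \<Rightarrow> real) \<Rightarrow> ('a \<times> 'b) set \<Rightarrow> real" where
  "strength D E = (\<lambda>(a, \<nu>). \<lambda>U\<in>{U. openin (scott_topology (D \<times>\<^sub>D E)) U}.
     vintegral E \<nu> (\<lambda>y. indicator U (a, y)))"

definition fmap :: "'a gorder \<Rightarrow> 'b gorder \<Rightarrow> ('a \<Rightarrow> 'b) \<Rightarrow> ('a set \<Rightarrow> real) \<Rightarrow> 'b set \<Rightarrow> real" where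
  "fmap D E h = kleisli D E (\<lambda>x. dirac E (h x))"

definition kl_mult :: "'a gorder \<Rightarrow> (('a set \<Rightarrow> real) set \<Rightarrow> real) \<Rightarrow> 'a set \<Rightarrow> real" where
  "kl_mult D = kleisli (\<M> D) D (\<lambda>\<nu>. \<nu>)"

definition costrength ::
  "'a gorder \<Rightarrow> 'b gorder \<Rightarrow> ('a set \<Rightarrow> real) \<times> 'b \<Rightarrow> ('a \<times> 'b) set \<Rightarrow> real" where
  "costrength D E = (\<lambda>(\<nu>, b). fmap (E \<times>\<^sub>D D) (D \<times>\<^sub>D E) prod.swap (strength E D (b, \<nu>)))"

end

theory Submission
  imports Defs
begin

text \<open>
  Directed suprema of real-valued monotone maps are limits along the filter of tails of the directed
  set. Integrands \<open>t \<mapsto> \<nu> (f -` {t<..1})\<close> are antitone, so their Riemann sums converge uniformly, and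
  integration is therefore Scott-continuous both in the valuation and in the integrand. Two
  Scott-continuous maps on \<open>\<M> D\<close> that agree on simple valuations agree everywhere, because \<open>\<M> D\<close> is the
  least sub-dcpo containing them; on simple valuations integrals are finite sums. This principle
  yields linearity in the integrand, the change of variables formula
  \<open>\<integral>h d(f\<^sup>\<dagger>\<nu>) = \<integral>\<integral>h d(f x) d\<nu>\<close> and Fubini's theorem. A member of \<open>\<M> D\<close> is determined by the
  integrals against it, hence the laws of a commutative strong monad are calculations with
  integrals of an arbitrary test function.
\<close>

section \<open>Directed suprema as limits\<close>

text \<open>The integral is defined through level sets. It is therefore visibly linear in the
  valuation but not in the integrand; on \<M> D the second linearity has to be recovered from simple
  valuations. Iterated integrals make a further demand: an integral depending on a parameter must
  again be Scott-continuous before it can be integrated, also jointly in a point and a valuation.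
  The Scott topology of a product may be finer than the product topology, yet separate Scott
  continuity is enough, because a directed subset of a product is cofinal in the product of its
  projections. Kleisli extension meets another obstacle. For simple \<nu> the result is a weighted
  sum of values of \<open>f\<close>, and these are arbitrary members of \<M> E. Hence \<M> E must
  first be shown closed under finite sums with nonnegative weights of total at most 1.\<close>

lemma is_lub_iff:
  assumes "A \<subseteq> carrier D"
  shows "is_lub D A s \<longleftrightarrow> s \<in> carrier D \<and> (\<forall>a\<in>A. a \<sqsubseteq>\<^bsub>D\<^esub> s) \<and>
    (\<forall>u\<in>carrier D. (\<forall>a\<in>A. a \<sqsubseteq>\<^bsub>D\<^esub> u) \<longrightarrow> s \<sqsubseteq>\<^bsub>D\<^esub> u)"
  using assms unfolding is_lub_def least_def Upper_def by blast

lemma is_lub_carrier: "is_lub D A s \<Longrightarrow> s \<in> carrier D"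
  by (auto simp: is_lub_def least_def Upper_def)

lemma partial_orderI:
  assumes "eq D = (=)"
    and "\<And>x. x \<in> carrier D \<Longrightarrow> x \<sqsubseteq>\<^bsub>D\<^esub> x"
    and "\<And>x y. \<lbrakk>x \<in> carrier D; y \<in> carrier D; x \<sqsubseteq>\<^bsub>D\<^esub> y; y \<sqsubseteq>\<^bsub>D\<^esub> x\<rbrakk> \<Longrightarrow> x = y"
    and "\<And>x y z. \<lbrakk>x \<in> carrier D; y \<in> carrier D; z \<in> carrier D; x \<sqsubseteq>\<^bsub>D\<^esub> y; y \<sqsubseteq>\<^bsub>D\<^esub> z\<rbrakk> \<Longrightarrow> x \<sqsubseteq>\<^bsub>D\<^esub> z"
  shows "partial_order D"
proof unfold_locales
  show "x \<sqsubseteq>\<^bsub>D\<^esub> z" if "x \<sqsubseteq>\<^bsub>D\<^esub> y" "y \<sqsubseteq>\<^bsub>D\<^esub> z" "x \<in> carrier D" "y \<in> carrier D" "z \<in> carrier D" for x y z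
    using assms(4) that by blast
qed (simp_all add: assms(1-3))

lemma partial_order_refl: "partial_order D \<Longrightarrow> x \<in> carrier D \<Longrightarrow> x \<sqsubseteq>\<^bsub>D\<^esub> x"
  by (simp add: partial_order_def weak_partial_order.le_refl)

lemma partial_order_trans:
  "\<lbrakk>partial_order D; x \<sqsubseteq>\<^bsub>D\<^esub> y; y \<sqsubseteq>\<^bsub>D\<^esub> z; x \<in> carrier D; y \<in> carrier D; z \<in> carrier D\<rbrakk> \<Longrightarrow> x \<sqsubseteq>\<^bsub>D\<^esub> z"
  unfolding partial_order_def by (metis weak_partial_order.le_trans)

lemma partial_order_antisym:
  "\<lbrakk>partial_order D; x \<sqsubseteq>\<^bsub>D\<^esub> y; y \<sqsubseteq>\<^bsub>D\<^esub> x; x \<in> carrier D; y \<in> carrier D\<rbrakk> \<Longrightarrow> x = y"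
  by (metis partial_order.le_antisym)

lemma is_lub_unique:
  assumes "partial_order D" "A \<subseteq> carrier D" "is_lub D A s" "is_lub D A t"
  shows "s = t"
  by (metis assms is_lub_iff partial_order_antisym)

text \<open>An indexed form of directed families: the index set \<open>A\<close> carries the order
  of \<open>D\<close>, and different indices may share a value. This lets one directed set of
  valuations or points index nets of reals, open sets and valuations.\<close>

definition mono_into :: "'a gorder \<Rightarrow> 'a set \<Rightarrow> 'b gorder \<Rightarrow> ('a \<Rightarrow> 'b) \<Rightarrow> bool" where
  "mono_into D A E f \<longleftrightarrow> f \<in> A \<rightarrow> carrier E \<and> (\<forall>x\<in>A. \<forall>y\<in>A. x \<sqsubseteq>\<^bsub>D\<^esub> y \<longrightarrow> f x \<sqsubseteq>\<^bsub>E\<^esub> f y)"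

lemma directed_image:
  assumes "directed D A" "mono_into D A E f"
  shows "directed E (f ` A)"
  using assms unfolding directed_def mono_into_def
  by (auto simp: Pi_iff image_iff) (metis subset_eq)

text \<open>The tails of a directed set form a filter base, since a common upper bound of two
  indices has its tail inside both. Along this filter the library theorems on limits of sums and
  products apply to suprema.\<close>

definition tails :: "'a gorder \<Rightarrow> 'a set \<Rightarrow> 'a filter" where
  "tails D A = (INF a\<in>A. principal {x\<in>A. a \<sqsubseteq>\<^bsub>D\<^esub> x})"

lemma eventually_tails:
  assumes "partial_order D" "directed D A"
  shows "eventually P (tails D A) \<longleftrightarrow> (\<exists>a\<in>A. \<forall>x\<in>A. a \<sqsubseteq>\<^bsub>D\<^esub> x \<longrightarrow> P x)"
  unfolding tails_def
proof (subst eventually_INF_base)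
  show "A \<noteq> {}" using assms by (simp add: directed_def)
  fix a b assume ab: "a \<in> A" "b \<in> A"
  then obtain c where c: "c \<in> A" "a \<sqsubseteq>\<^bsub>D\<^esub> c" "b \<sqsubseteq>\<^bsub>D\<^esub> c"
    using assms(2) unfolding directed_def by blast
  have "A \<subseteq> carrier D" using assms(2) by (simp add: directed_def)
  then show "\<exists>c\<in>A. principal {x \<in> A. c \<sqsubseteq>\<^bsub>D\<^esub> x} \<le> inf (principal {x \<in> A. a \<sqsubseteq>\<^bsub>D\<^esub> x}) (principal {x \<in> A. b \<sqsubseteq>\<^bsub>D\<^esub> x})"
    using c ab by (intro bexI[of _ c]) (auto intro: partial_order_trans[OF assms(1)])
qed (auto simp: eventually_principal)

lemma eventually_tails_in:
  assumes "partial_order D" "directed D A"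
  shows "eventually (\<lambda>x. x \<in> A) (tails D A)"
  using assms by (auto simp: eventually_tails) (auto simp: directed_def)

lemma tails_ne_bot:
  assumes "partial_order D" "directed D A"
  shows "tails D A \<noteq> bot"
  unfolding trivial_limit_def eventually_tails[OF assms]
  using assms partial_order_refl unfolding directed_def by fastforce

lemma carrier_unit_interval [simp]: "carrier unit_interval_order = {0..1}"
  and le_unit_interval [simp]: "(x \<sqsubseteq>\<^bsub>unit_interval_order\<^esub> y) = (x \<le> y)"
  by (simp_all add: unit_interval_order_def)

lemma tendsto_tails_upper:
  assumes "partial_order D" "directed D A" "mono_into D A unit_interval_order g"
    "(g \<longlongrightarrow> s) (tails D A)" "a \<in> A"
  shows "g a \<le> s"
proof (rule tendsto_lowerbound[OF assms(4) _ tails_ne_bot[OF assms(1,2)]])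
  show "\<forall>\<^sub>F x in tails D A. g a \<le> g x"
    unfolding eventually_tails[OF assms(1,2)]
    using assms(3,5) by (auto simp: mono_into_def)
qed

lemma tendsto_tails_least:
  assumes "partial_order D" "directed D A"
    "(g \<longlongrightarrow> (s::real)) (tails D A)" "\<And>a. a \<in> A \<Longrightarrow> g a \<le> u"
  shows "s \<le> u"
  using assms(3) _ tails_ne_bot[OF assms(1,2)]
  by (rule tendsto_upperbound) (rule eventually_mono[OF eventually_tails_in[OF assms(1,2)] assms(4)])

lemma tendsto_tails_greatest:
  assumes "partial_order D" "directed D A"
    "(g \<longlongrightarrow> (s::real)) (tails D A)" "\<And>a. a \<in> A \<Longrightarrow> u \<le> g a"
  shows "u \<le> s"
  using assms(3) _ tails_ne_bot[OF assms(1,2)]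
  by (rule tendsto_lowerbound) (rule eventually_mono[OF eventually_tails_in[OF assms(1,2)] assms(4)])

text \<open>A monotone net stays above each of its values, so it eventually exceeds every number
  below its supremum; conversely its limit bounds all its values, and every upper bound of the
  values bounds the limit.\<close>

lemma is_lub_unit_interval_iff_tendsto:
  assumes "partial_order D" "directed D A" "mono_into D A unit_interval_order g"
  shows "is_lub unit_interval_order (g ` A) s \<longleftrightarrow> (g \<longlongrightarrow> s) (tails D A)"
proof
  have g: "g ` A \<subseteq> {0..1}" using assms(3) by (auto simp: mono_into_def)
  assume "is_lub unit_interval_order (g ` A) s"
  then have s: "s \<in> {0..1}" "\<And>a. a \<in> A \<Longrightarrow> g a \<le> s" "\<And>u. u \<in> {0..1} \<Longrightarrow> (\<And>a. a \<in> A \<Longrightarrow> g a \<le> u) \<Longrightarrow> s \<le> u"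
    using g by (auto simp: is_lub_iff)
  show "(g \<longlongrightarrow> s) (tails D A)"
  proof (rule order_tendstoI)
    fix l assume "l < s"
    have "\<exists>a\<in>A. l < g a"
    proof (rule ccontr)
      assume "\<not> ?thesis"
      \<comment> \<open>Leastness of \<open>s\<close> is known only against bounds in the unit
        interval. A member of the nonempty \<open>A\<close> gives
        \<open>0 \<le> g a \<le> l\<close>, and \<open>l < s \<le> 1\<close> gives the other
        side.\<close>
      moreover obtain a where "a \<in> A" using assms(2) by (auto simp: directed_def)
      ultimately have "s \<le> l"
        using g s(1) \<open>l < s\<close> by (intro s(3)) (force simp: not_less)+
      with \<open>l < s\<close> show False by simp
    qed
    then show "\<forall>\<^sub>F x in tails D A. l < g x"
      unfolding eventually_tails[OF assms(1,2)] using assms(3)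
      by (force simp: mono_into_def)
  next
    fix u assume "s < u"
    then show "\<forall>\<^sub>F x in tails D A. g x < u"
      using s(2) by (intro eventually_mono[OF eventually_tails_in[OF assms(1,2)]]) force
  qed
next
  assume lim: "(g \<longlongrightarrow> s) (tails D A)"
  have g: "\<And>a. a \<in> A \<Longrightarrow> 0 \<le> g a \<and> g a \<le> 1" using assms(3) by (auto simp: mono_into_def Pi_iff)
  have "s \<in> {0..1}"
    using g tendsto_tails_least[OF assms(1,2) lim, of 1] tendsto_tails_greatest[OF assms(1,2) lim, of 0]
    by auto
  then show "is_lub unit_interval_order (g ` A) s"
    using g by (subst is_lub_iff) (auto intro: tendsto_tails_upper[OF assms lim] tendsto_tails_least[OF assms(1,2) lim])
qed

lemma ex_tendsto_tails:
  assumes "partial_order D" "directed D A" "mono_into D A unit_interval_order g"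
  shows "\<exists>s. (g \<longlongrightarrow> s) (tails D A)"
proof -
  have g: "\<And>a. a \<in> A \<Longrightarrow> 0 \<le> g a \<and> g a \<le> 1" "A \<noteq> {}"
    using assms(2,3) by (auto simp: mono_into_def Pi_iff directed_def)
  then have b: "bdd_above (g ` A)" by (auto intro!: bdd_aboveI[of _ 1])
  obtain a where a: "a \<in> A" using g(2) by auto
  have "0 \<le> (SUP a\<in>A. g a)" using g(1)[OF a] cSUP_upper[OF a b] by linarith
  then have "is_lub unit_interval_order (g ` A) (SUP a\<in>A. g a)"
    using g b by (subst is_lub_iff) (auto intro!: cSUP_upper cSUP_least)
  then show ?thesis using is_lub_unit_interval_iff_tendsto[OF assms] by blast
qed

section \<open>Scott-continuous maps, in particular into the unit interval\<close>

abbreviation scont :: "'a gorder \<Rightarrow> ('a \<Rightarrow> real) \<Rightarrow> bool" where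
  "scont D f \<equiv> scott_continuous D unit_interval_order f"

lemma scott_continuous_mono_into:
  "scott_continuous D E f \<Longrightarrow> A \<subseteq> carrier D \<Longrightarrow> mono_into D A E f"
  by (auto simp: scott_continuous_def mono_into_def Pi_iff subset_iff)

text \<open>In this form, closure under weighted sums is the arithmetic of limits, and equality of
  two continuous maps passes to suprema by uniqueness of limits.\<close>

lemma scont_iff_tendsto:
  assumes "partial_order D"
  shows "scont D f \<longleftrightarrow> mono_into D (carrier D) unit_interval_order f \<and>
    (\<forall>A s. directed D A \<and> is_lub D A s \<longrightarrow> (f \<longlongrightarrow> f s) (tails D A))" (is "?L \<longleftrightarrow> ?R")
proof -
  have "is_lub unit_interval_order (f ` A) (f s) \<longleftrightarrow> (f \<longlongrightarrow> f s) (tails D A)"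
    if "mono_into D (carrier D) unit_interval_order f" "directed D A" for A s
    using that by (intro is_lub_unit_interval_iff_tendsto[OF assms])
      (auto simp: mono_into_def directed_def Pi_iff subset_iff)
  moreover have "?L \<longleftrightarrow> mono_into D (carrier D) unit_interval_order f \<and>
    (\<forall>A s. directed D A \<and> is_lub D A s \<longrightarrow> is_lub unit_interval_order (f ` A) (f s))"
    unfolding scott_continuous_def mono_into_def by auto
  ultimately show ?thesis by metis
qed

lemma scontD_bounds:
  assumes "scont D f" "x \<in> carrier D"
  shows "0 \<le> f x" "f x \<le> 1"
  using assms by (auto simp: scott_continuous_def Pi_iff)

lemma scont_tendsto_image:
  assumes "partial_order X" "directed X A" "mono_into X A D \<phi>" "is_lub D (\<phi> ` A) s" "scont D f"
  shows "((\<lambda>a. f (\<phi> a)) \<longlongrightarrow> f s) (tails X A)"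
proof -
  have "directed D (\<phi> ` A)" by (rule directed_image[OF assms(2,3)])
  then have "is_lub unit_interval_order (f ` \<phi> ` A) (f s)"
    using assms(4,5) unfolding scott_continuous_def by blast
  moreover have "mono_into X A unit_interval_order (\<lambda>a. f (\<phi> a))"
    using assms(3,5) unfolding mono_into_def scott_continuous_def by (auto simp: Pi_iff)
  ultimately show ?thesis
    using is_lub_unit_interval_iff_tendsto[OF assms(1,2)] by (simp add: image_image)
qed

lemma scott_continuous_cong:
  assumes "scott_continuous D E f" "\<And>x. x \<in> carrier D \<Longrightarrow> f x = g x"
  shows "scott_continuous D E g"
proof -
  have "is_lub E (g ` A) (g s)" if A: "directed D A" "is_lub D A s" for A s
  proof -
    have "f ` A = g ` A"
      using A(1) assms(2) by (intro image_cong) (auto simp: directed_def)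
    moreover have "f s = g s"
      using assms(2) is_lub_carrier[OF A(2)] by simp
    moreover have "is_lub E (f ` A) (f s)"
      using assms(1) A unfolding scott_continuous_def by blast
    ultimately show ?thesis by simp
  qed
  then show ?thesis
    using assms unfolding scott_continuous_def by (auto simp: Pi_iff)
qed

lemma scott_continuous_compose:
  assumes "scott_continuous D E f" "scott_continuous E F g"
  shows "scott_continuous D F (\<lambda>x. g (f x))"
proof -
  have "is_lub F ((\<lambda>x. g (f x)) ` A) (g (f s))" if "directed D A" "is_lub D A s" for A s
  proof -
    have "directed E (f ` A)"
      by (rule directed_image[OF that(1) scott_continuous_mono_into[OF assms(1)]])
        (use that(1) in \<open>auto simp: directed_def\<close>)
    then show ?thesis
      using assms that unfolding scott_continuous_def image_image[symmetric, of g f] by blast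
  qed
  then show ?thesis
    using assms unfolding scott_continuous_def by (auto simp: Pi_iff)
qed

lemma scott_continuous_id: "scott_continuous D D (\<lambda>x. x)"
  by (auto simp: scott_continuous_def)

lemma scont_indicator:
  assumes "scott_open D U"
  shows "scont D (indicator U)"
proof -
  have "is_lub unit_interval_order (indicator U ` A) (indicator U s)" if A: "directed D A" "is_lub D A s" for A s
  proof -
    have sub: "A \<subseteq> carrier D" using A by (simp add: directed_def)
    have up: "\<forall>a\<in>A. a \<sqsubseteq>\<^bsub>D\<^esub> s" "s \<in> carrier D" using A sub by (auto simp: is_lub_iff)
    have a: "a \<in> A \<Longrightarrow> a \<in> U \<Longrightarrow> s \<in> U" for a using assms up unfolding scott_open_def by blast
    show ?thesis
    proof (cases "s \<in> U")
      case True
      then obtain a where "a \<in> A" "a \<in> U" using assms A unfolding scott_open_def by blast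
      with True show ?thesis by (subst is_lub_iff) (auto simp: indicator_def)
    next
      case False
      then have "\<forall>a\<in>A. a \<notin> U" using a by blast
      with False A show ?thesis by (subst is_lub_iff) (auto simp: indicator_def directed_def)
    qed
  qed
  moreover have "indicator U x \<le> (indicator U y :: real)"
    if "x \<in> carrier D" "y \<in> carrier D" "x \<sqsubseteq>\<^bsub>D\<^esub> y" for x y
    using assms that unfolding scott_open_def indicator_def by auto
  ultimately show ?thesis
    unfolding scott_continuous_def by (simp add: indicator_def)
qed

lemma scott_open_vimage_greaterThan:
  assumes "scont D f"
  shows "scott_open D (f -` {t<..1} \<inter> carrier D)"
  unfolding scott_open_def
proof (intro conjI allI ballI impI)
  fix x y assume *: "x \<in> f -` {t<..1} \<inter> carrier D" "y \<in> carrier D" "x \<sqsubseteq>\<^bsub>D\<^esub> y"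
  then have "f x \<le> f y"
    using assms unfolding scott_continuous_def by auto
  with * show "y \<in> f -` {t<..1} \<inter> carrier D"
    using scontD_bounds(2)[OF assms *(2)] by auto
next
  fix A s assume A: "directed D A \<and> is_lub D A s \<and> s \<in> f -` {t<..1} \<inter> carrier D"
  then have lub: "is_lub unit_interval_order (f ` A) (f s)"
    using assms unfolding scott_continuous_def by blast
  have sub: "A \<subseteq> carrier D" "A \<noteq> {}" using A by (auto simp: directed_def)
  then have b: "f a \<in> {0..1}" if "a \<in> A" for a using that scontD_bounds[OF assms] by auto
  have "\<exists>a\<in>A. t < f a"
  proof (rule ccontr)
    assume *: "\<not> ?thesis"
    obtain a where a: "a \<in> A" using sub by auto
    have "f a \<le> t" using * a by force
    \<comment> \<open>If no value on \<open>A\<close> exceeds \<open>t\<close>, then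
      \<open>0 \<le> f a \<le> t\<close>, while \<open>t < f s \<le> 1\<close>. So \<open>t\<close>
      is an admissible upper bound and contradicts leastness of \<open>f s\<close>.\<close>
    then have "t \<in> {0..1}" using b[OF a] A by auto
    moreover have "\<forall>u\<in>{0..1}. (\<forall>a\<in>A. f a \<le> u) \<longrightarrow> f s \<le> u"
      using lub b by (subst (asm) is_lub_iff) (auto)
    ultimately have "f s \<le> t" using * by force
    with A show False by auto
  qed
  then show "A \<inter> (f -` {t<..1} \<inter> carrier D) \<noteq> {}"
    using sub b by force
qed auto

section \<open>Riemann sums of antitone functions\<close>

lemma antimono_integrable:
  fixes g :: "real \<Rightarrow> real"
  assumes "antimono_on {a..b} g"
  shows "g integrable_on {a..b}"
proof -
  have "mono_on {a..b} (\<lambda>x. - g x)" using assms by (auto simp: monotone_on_def)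
  then have "(\<lambda>x. - g x) integrable_on {a..b}" by (rule integrable_on_mono_on)
  from integrable_neg[OF this] show ?thesis by simp
qed

text \<open>For antitone \<open>g\<close> the right-endpoint sums lie below the integral and the
  left-endpoint sums above it. The two differ by a telescoping sum, so the error depends on
  \<open>g 0 - g 1\<close> and \<open>n\<close> only. This is what makes the approximation uniform
  over a family.\<close>

lemma antimono_integral_riemann_sum:
  fixes g :: "real \<Rightarrow> real"
  assumes "antimono_on {0..1} g" "n > 0"
  shows "(\<Sum>k<n. g (real (Suc k) / n)) / n \<le> integral {0..1} g"
    "integral {0..1} g \<le> (\<Sum>k<n. g (real (Suc k) / n)) / n + (g 0 - g 1) / n"
proof -
  \<comment> \<open>Both estimates are proved for the initial segments ending at \<open>m/n\<close>,
    so that each induction step adds one cell on which \<open>g\<close> lies between its endpoint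
    values.\<close>
  have *: "(\<Sum>k<m. g (real (Suc k) / n)) / n \<le> integral {0..m/n} g \<and>
     integral {0..m/n} g \<le> (\<Sum>k<m. g (real k / n)) / n" if "m \<le> n" for m
    using that
  proof (induction m)
    case (Suc m)
    have m: "real m / n \<le> real (Suc m) / n" "real (Suc m) / n \<le> 1" "0 \<le> real m / n"
      using Suc.prems \<open>n > 0\<close> by (auto simp: divide_simps)
    have am: "antimono_on {0..real (Suc m) / n} g" "antimono_on {real m / n..real (Suc m) / n} g"
      by (rule monotone_on_subset[OF assms(1)], unfold atLeastatMost_subset_iff, use m in linarith)+
    have split: "integral {0..real (Suc m) / n} g = integral {0..m/n} g + integral {real m / n..real (Suc m) / n} g"
      using m by (intro Henstock_Kurzweil_Integration.integral_combine[symmetric] antimono_integrable am) auto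
    have len: "real (Suc m) / n - real m / n = 1 / n" by (simp add: add_divide_distrib)
    have "integral {real m / n..real (Suc m) / n} (\<lambda>_. g (real (Suc m) / n)) \<le> integral {real m / n..real (Suc m) / n} g"
      using m am by (intro integral_le antimono_integrable) (auto simp: monotone_on_def)
    then have lo: "g (real (Suc m) / n) / n \<le> integral {real m / n..real (Suc m) / n} g"
      using m(1) len by simp
    have "integral {real m / n..real (Suc m) / n} g \<le> integral {real m / n..real (Suc m) / n} (\<lambda>_. g (real m / n))"
      using m am by (intro integral_le antimono_integrable) (auto simp: monotone_on_def)
    then have hi: "integral {real m / n..real (Suc m) / n} g \<le> g (real m / n) / n"
      using m(1) len by simp
    show ?case using Suc lo hi split by (simp add: add_divide_distrib)
  qed simp
  have tel: "(\<Sum>k<n. g (real k / n)) = (\<Sum>k<n. g (real (Suc k) / n)) + (g 0 - g 1)"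
    using sum_lessThan_telescope[of "\<lambda>k. g (real k / n)" n] \<open>n > 0\<close>
    by (simp add: sum_subtractf)
  show "(\<Sum>k<n. g (real (Suc k) / n)) / n \<le> integral {0..1} g"
    "integral {0..1} g \<le> (\<Sum>k<n. g (real (Suc k) / n)) / n + (g 0 - g 1) / n"
    using *[of n] tel \<open>n > 0\<close> by (simp_all add: add_divide_distrib)
qed

text \<open>Limits of nets do not commute with integrals in general; for antitone functions with values
  in the unit interval they do, because the Riemann sums converge uniformly.\<close>

lemma tendsto_integral_antimono:
  fixes g :: "'i \<Rightarrow> real \<Rightarrow> real"
  assumes ev: "\<forall>\<^sub>F i in F. antimono_on {0..1} (g i) \<and> g i \<in> {0..1} \<rightarrow> {0..1}"
    and lim: "\<And>t. t \<in> {0..1} \<Longrightarrow> ((\<lambda>i. g i t) \<longlongrightarrow> h t) F"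
    and h: "antimono_on {0..1} h" "h \<in> {0..1} \<rightarrow> {0..1}"
  shows "((\<lambda>i. integral {0..1} (g i)) \<longlongrightarrow> integral {0..1} h) F"
proof (rule tendstoI)
  fix e :: real assume "e > 0"
  \<comment> \<open>Replacing each of the two integrals by its Riemann sum costs at most
    \<open>1 / n\<close>. The finite sums, which converge termwise, are left with the tolerance
    \<open>e - 2 / n\<close>, positive by this choice of \<open>n\<close>.\<close>
  then obtain n :: nat where n: "n > 0" "1 / n < e / 2"
    by (metis half_gt_zero_iff nat_approx_posE of_nat_0_less_iff zero_less_Suc)
  define L where "L = (\<lambda>g::real\<Rightarrow>real. (\<Sum>k<n. g (real (Suc k) / n)) / n)"
  have L: "\<bar>integral {0..1} g - L g\<bar> \<le> 1 / n" if "antimono_on {0..1} g" "g \<in> {0..1} \<rightarrow> {0..1}" for g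
  proof -
    have "g 0 \<in> {0..1}" "g 1 \<in> {0..1}" using that(2) by (auto simp: Pi_iff)
    then have "(g 0 - g 1) / n \<le> 1 / n" using n(1) by (intro divide_right_mono) auto
    then show ?thesis
      using antimono_integral_riemann_sum[OF that(1) n(1)] unfolding L_def by linarith
  qed
  have "((\<lambda>i. L (g i)) \<longlongrightarrow> L h) F"
    unfolding L_def using n(1) by (intro tendsto_divide tendsto_sum lim tendsto_const) auto
  then have "\<forall>\<^sub>F i in F. dist (L (g i)) (L h) < e - 2 / n"
    using n(2) by (intro tendstoD) auto
  with ev show "\<forall>\<^sub>F i in F. dist (integral {0..1} (g i)) (integral {0..1} h) < e"
  proof eventually_elim
    case (elim i)
    then show ?case
      using L[of "g i"] L[OF h] unfolding dist_real_def by (simp add: abs_if split: if_splits)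
  qed
qed

section \<open>Valuations and their suprema\<close>

abbreviation opens :: "'a gorder \<Rightarrow> 'a set gorder" where
  "opens D \<equiv> opens_order (scott_topology D)"

lemma carrier_opens [simp]: "carrier (opens D) = {U. scott_open D U}"
  and le_opens [simp]: "(U \<sqsubseteq>\<^bsub>opens D\<^esub> V) = (U \<subseteq> V)"
  by (simp_all add: opens_order_def)

lemma partial_order_opens: "partial_order (opens D)"
  by (rule partial_orderI) (auto simp: opens_order_def)

lemma scott_open_Un: "scott_open D U \<Longrightarrow> scott_open D V \<Longrightarrow> scott_open D (U \<union> V)"
  and scott_open_Int: "scott_open D U \<Longrightarrow> scott_open D V \<Longrightarrow> scott_open D (U \<inter> V)"
  and scott_open_empty: "scott_open D {}"
  and scott_open_Union: "(\<And>U. U \<in> B \<Longrightarrow> scott_open D U) \<Longrightarrow> scott_open D (\<Union>B)"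
  using openin_Un[of "scott_topology D"] openin_Int[of "scott_topology D"]
    openin_empty[of "scott_topology D"] openin_Union[of B "scott_topology D"] by auto

lemma is_lub_opens_iff:
  assumes "B \<subseteq> carrier (opens D)"
  shows "is_lub (opens D) B W \<longleftrightarrow> W = \<Union>B"
proof
  assume "is_lub (opens D) B W"
  moreover have "scott_open D (\<Union>B)" using assms by (auto intro: scott_open_Union)
  ultimately show "W = \<Union>B"
    using assms by (auto simp: is_lub_iff)
next
  assume "W = \<Union>B"
  moreover have "scott_open D (\<Union>B)" using assms by (auto intro: scott_open_Union)
  ultimately show "is_lub (opens D) B W"
    using assms by (auto simp: is_lub_iff)
qed

lemma le_V [simp]: "(\<nu> \<sqsubseteq>\<^bsub>\<V> D\<^esub> \<xi>) = (\<forall>U. scott_open D U \<longrightarrow> \<nu> U \<le> \<xi> U)"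
  and carrier_V: "carrier (\<V> D) = {\<nu>. \<nu> \<in> extensional {U. scott_open D U} \<and>
     scont (opens D) \<nu> \<and> \<nu> {} = 0 \<and>
     (\<forall>U V. scott_open D U \<and> scott_open D V \<longrightarrow> \<nu> U + \<nu> V = \<nu> (U \<union> V) + \<nu> (U \<inter> V))}"
  by (simp_all add: \<V>_def subprob_valuation_def)

lemma V_bounds:
  assumes "\<nu> \<in> carrier (\<V> D)" "scott_open D U"
  shows "0 \<le> \<nu> U" "\<nu> U \<le> 1"
  using assms scontD_bounds[of "opens D" \<nu> U] by (auto simp: carrier_V)

lemma V_mono:
  assumes "\<nu> \<in> carrier (\<V> D)" "scott_open D U" "scott_open D V" "U \<subseteq> V"
  shows "\<nu> U \<le> \<nu> V"
  using assms by (auto simp: carrier_V scott_continuous_def)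

lemma V_tendsto_UN:
  assumes "partial_order X" "directed X A" "\<nu> \<in> carrier (\<V> D)"
    and "mono_into X A (opens D) \<phi>"
  shows "((\<lambda>a. \<nu> (\<phi> a)) \<longlongrightarrow> \<nu> (\<Union>a\<in>A. \<phi> a)) (tails X A)"
proof (rule scont_tendsto_image[OF assms(1,2,4)])
  show "is_lub (opens D) (\<phi> ` A) (\<Union>a\<in>A. \<phi> a)"
    using assms(4) by (subst is_lub_opens_iff) (auto simp: mono_into_def)
  show "scont (opens D) \<nu>" using assms(3) by (simp add: carrier_V)
qed

lemma V_eqI:
  assumes "\<mu> \<in> carrier (\<V> D)" "\<nu> \<in> carrier (\<V> D)" "\<And>U. scott_open D U \<Longrightarrow> \<mu> U = \<nu> U"
  shows "\<mu> = \<nu>"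
  using assms by (intro extensionalityI[of _ "{U. scott_open D U}"]) (auto simp: carrier_V)

lemma partial_order_V: "partial_order (\<V> D)"
proof (rule partial_orderI)
  fix x y assume "x \<in> carrier (\<V> D)" "y \<in> carrier (\<V> D)" "x \<sqsubseteq>\<^bsub>\<V> D\<^esub> y" "y \<sqsubseteq>\<^bsub>\<V> D\<^esub> x"
  then show "x = y" by (intro V_eqI) (auto intro: order.antisym)
qed (auto simp: \<V>_def intro: order_trans)

lemma mono_into_V_apply:
  assumes "mono_into X A (\<V> D) \<phi>" "scott_open D U"
  shows "mono_into X A unit_interval_order (\<lambda>a. \<phi> a U)"
  using assms unfolding mono_into_def by (auto simp: Pi_iff intro: V_bounds)

text \<open>Bounds, monotonicity and modularity are closed conditions on finitely many values, so
  they survive pointwise limits. Only Scott continuity of \<open>s\<close> needs an argument, namely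
  the exchange of the supremum over \<open>A\<close> with that over a directed family of open
  sets.\<close>

lemma V_limit:
  assumes X: "partial_order X" "directed X A" and \<phi>: "mono_into X A (\<V> D) \<phi>"
    and s: "s \<in> extensional {U. scott_open D U}"
    and lim: "\<And>U. scott_open D U \<Longrightarrow> ((\<lambda>a. \<phi> a U) \<longlongrightarrow> s U) (tails X A)"
  shows "s \<in> carrier (\<V> D)" "is_lub (\<V> D) (\<phi> ` A) s"
proof -
  note least = tendsto_tails_least[OF X lim]
  note upper = tendsto_tails_upper[OF X mono_into_V_apply[OF \<phi>] lim]
  note unique = tendsto_unique[OF tails_ne_bot[OF X]]
  have V: "\<phi> a \<in> carrier (\<V> D)" if "a \<in> A" for a using \<phi> that by (auto simp: mono_into_def)
  have bounds: "0 \<le> s U" "s U \<le> 1" if "scott_open D U" for U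
    using that V_bounds[OF V that] least[OF that, of 1] tendsto_tails_greatest[OF X lim, OF that, of 0] by auto
  have mono: "s U \<le> s W" if "scott_open D U" "scott_open D W" "U \<subseteq> W" for U W
    using that V_mono[OF V that] upper[OF that(2,2)] by (intro least) (auto intro: order_trans)
  have lub: "is_lub unit_interval_order (s ` B) (s W)" if B: "directed (opens D) B" "is_lub (opens D) B W" for B W
  proof -
    have sub: "B \<subseteq> carrier (opens D)" "B \<noteq> {}" using B by (simp_all add: directed_def)
    then have W: "W = \<Union>B" "scott_open D W" using B is_lub_opens_iff[OF sub(1)] is_lub_carrier[OF B(2)] by auto
    \<comment> \<open>A bound \<open>u\<close> of all \<open>s U\<close> bounds every
      \<open>\<phi> a U\<close>, hence \<open>\<phi> a W\<close> by continuity of the single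
      valuation \<open>\<phi> a\<close>, and hence the limit \<open>s W\<close>.\<close>
    have "s W \<le> u" if u: "u \<in> {0..1}" "\<forall>U\<in>B. s U \<le> u" for u
    proof (rule least[OF W(2)])
      fix a assume a: "a \<in> A"
      have "scont (opens D) (\<phi> a)" using V[OF a] by (simp add: carrier_V)
      then have "is_lub unit_interval_order (\<phi> a ` B) (\<phi> a W)"
        using B unfolding scott_continuous_def by blast
      moreover have "\<phi> a U \<le> u" if "U \<in> B" for U
        using upper[of U, OF _ _ a] u(2) that sub by fastforce
      ultimately show "\<phi> a W \<le> u"
        using u V_bounds[OF V[OF a]] sub by (subst (asm) is_lub_iff) (auto simp: subset_iff)
    qed
    then show ?thesis
      using bounds mono sub W by (subst is_lub_iff) (auto intro!: mono)
  qed
  have "s {} = 0"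
    using V unique[OF lim[OF scott_open_empty] tendsto_eventually[OF eventually_mono[OF eventually_tails_in[OF X]]]]
    by (simp add: carrier_V)
  moreover have "s U + s W = s (U \<union> W) + s (U \<inter> W)" if "scott_open D U" "scott_open D W" for U W
  proof (rule unique)
    show "((\<lambda>a. \<phi> a U + \<phi> a W) \<longlongrightarrow> s U + s W) (tails X A)"
      using that by (intro tendsto_add lim)
    have "((\<lambda>a. \<phi> a (U \<union> W) + \<phi> a (U \<inter> W)) \<longlongrightarrow> s (U \<union> W) + s (U \<inter> W)) (tails X A)"
      using that by (intro tendsto_add lim scott_open_Un scott_open_Int)
    then show "((\<lambda>a. \<phi> a U + \<phi> a W) \<longlongrightarrow> s (U \<union> W) + s (U \<inter> W)) (tails X A)"
      by (rule Lim_transform_eventually)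
        (rule eventually_mono[OF eventually_tails_in[OF X]], use V that in \<open>auto simp: carrier_V\<close>)
  qed
  ultimately show sV: "s \<in> carrier (\<V> D)"
    using s bounds mono lub unfolding carrier_V scott_continuous_def by auto
  show "is_lub (\<V> D) (\<phi> ` A) s"
    using V sV by (subst is_lub_iff) (auto intro: upper least)
qed

text \<open>The limits at the single open sets are collected by choice; restricting the resulting
  function supplies the extensionality that membership in the carrier demands.\<close>

lemma V_ex_limit:
  assumes X: "partial_order X" "directed X A" and \<phi>: "mono_into X A (\<V> D) \<phi>"
  obtains s where "s \<in> extensional {U. scott_open D U}"
    "\<And>U. scott_open D U \<Longrightarrow> ((\<lambda>a. \<phi> a U) \<longlongrightarrow> s U) (tails X A)"
proof -
  have "\<forall>U\<in>{U. scott_open D U}. \<exists>l. ((\<lambda>a. \<phi> a U) \<longlongrightarrow> l) (tails X A)"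
    using ex_tendsto_tails[OF X mono_into_V_apply[OF \<phi>]] by blast
  then obtain s where "\<forall>U\<in>{U. scott_open D U}. ((\<lambda>a. \<phi> a U) \<longlongrightarrow> s U) (tails X A)"
    by metis
  then show ?thesis
    by (intro that[of "restrict s {U. scott_open D U}"]) auto
qed

section \<open>Finite weighted sums, Dirac valuations and simple valuations\<close>

definition wsum :: "'a gorder \<Rightarrow> 'i set \<Rightarrow> ('i \<Rightarrow> real) \<Rightarrow> ('i \<Rightarrow> 'a set \<Rightarrow> real) \<Rightarrow> 'a set \<Rightarrow> real" where
  "wsum D I r \<mu> = (\<lambda>U\<in>{U. scott_open D U}. \<Sum>i\<in>I. r i * \<mu> i U)"

lemma wsum_apply: "scott_open D U \<Longrightarrow> wsum D I r \<mu> U = (\<Sum>i\<in>I. r i * \<mu> i U)"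
  by (simp add: wsum_def)

lemma wsum_bounds:
  assumes "\<And>i. i \<in> I \<Longrightarrow> 0 \<le> r i" "sum r I \<le> (1::real)" "\<And>i. i \<in> I \<Longrightarrow> 0 \<le> f i \<and> f i \<le> 1"
  shows "0 \<le> (\<Sum>i\<in>I. r i * f i)" "(\<Sum>i\<in>I. r i * f i) \<le> 1"
proof -
  show "0 \<le> (\<Sum>i\<in>I. r i * f i)" using assms by (auto intro!: sum_nonneg)
  have "(\<Sum>i\<in>I. r i * f i) \<le> sum r I"
    using assms by (intro sum_mono) (simp add: mult_left_le)
  then show "(\<Sum>i\<in>I. r i * f i) \<le> 1" using assms(2) by simp
qed

lemma scont_wsum:
  assumes "partial_order D" "\<And>i. i \<in> I \<Longrightarrow> 0 \<le> r i" "sum r I \<le> (1::real)" "\<And>i. i \<in> I \<Longrightarrow> scont D (f i)"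
  shows "scont D (\<lambda>x. \<Sum>i\<in>I. r i * f i x)"
proof -
  have "mono_into D (carrier D) unit_interval_order (\<lambda>x. \<Sum>i\<in>I. r i * f i x)"
    unfolding mono_into_def
  proof (intro conjI funcsetI ballI impI)
    fix x assume "x \<in> carrier D"
    then show "(\<Sum>i\<in>I. r i * f i x) \<in> carrier unit_interval_order"
      using wsum_bounds[of I r "\<lambda>i. f i x"] assms(2,3) scontD_bounds[OF assms(4)] by auto
  next
    fix x y assume "x \<in> carrier D" "y \<in> carrier D" "x \<sqsubseteq>\<^bsub>D\<^esub> y"
    then show "(\<Sum>i\<in>I. r i * f i x) \<sqsubseteq>\<^bsub>unit_interval_order\<^esub> (\<Sum>i\<in>I. r i * f i y)"
      using assms(2,4) by (auto simp: scott_continuous_def intro!: sum_mono mult_left_mono)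
  qed
  moreover have "((\<lambda>x. \<Sum>i\<in>I. r i * f i x) \<longlongrightarrow> (\<Sum>i\<in>I. r i * f i s)) (tails D A)"
    if "directed D A" "is_lub D A s" for A s
    using assms(4) that unfolding scont_iff_tendsto[OF assms(1)]
    by (intro tendsto_sum tendsto_mult tendsto_const) blast
  ultimately show ?thesis unfolding scont_iff_tendsto[OF assms(1)] by blast
qed

lemma wsum_V:
  assumes "\<And>i. i \<in> I \<Longrightarrow> 0 \<le> r i" "sum r I \<le> 1" "\<And>i. i \<in> I \<Longrightarrow> \<mu> i \<in> carrier (\<V> D)"
  shows "wsum D I r \<mu> \<in> carrier (\<V> D)"
proof -
  have "scont (opens D) (\<lambda>U. \<Sum>i\<in>I. r i * \<mu> i U)"
    using assms by (intro scont_wsum partial_order_opens) (auto simp: carrier_V)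
  then have "scont (opens D) (wsum D I r \<mu>)"
    by (rule scott_continuous_cong) (simp add: wsum_apply)
  moreover have "wsum D I r \<mu> {} = 0"
    using assms(3) by (auto simp: wsum_apply scott_open_empty carrier_V intro!: sum.neutral)
  moreover have "wsum D I r \<mu> U + wsum D I r \<mu> W = wsum D I r \<mu> (U \<union> W) + wsum D I r \<mu> (U \<inter> W)"
    if "scott_open D U" "scott_open D W" for U W
  proof -
    have "\<mu> i U + \<mu> i W = \<mu> i (U \<union> W) + \<mu> i (U \<inter> W)" if "i \<in> I" for i
      using assms(3)[OF that] \<open>scott_open D U\<close> \<open>scott_open D W\<close> by (simp add: carrier_V)
    then have "(\<Sum>i\<in>I. r i * (\<mu> i U + \<mu> i W)) = (\<Sum>i\<in>I. r i * (\<mu> i (U \<union> W) + \<mu> i (U \<inter> W)))"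
      by (intro sum.cong) auto
    then show ?thesis
      using that by (simp add: wsum_apply scott_open_Un scott_open_Int distrib_left sum.distrib)
  qed
  ultimately show ?thesis by (auto simp: carrier_V wsum_def)
qed

lemma dirac_apply: "scott_open D U \<Longrightarrow> dirac D x U = indicator U x"
  by (simp add: dirac_def indicator_def)

lemma dirac_V: "dirac D x \<in> carrier (\<V> D)"
proof -
  have "is_lub unit_interval_order (dirac D x ` B) (dirac D x W)"
    if B: "directed (opens D) B" "is_lub (opens D) B W" for B W
  proof -
    have sub: "B \<subseteq> carrier (opens D)" "B \<noteq> {}" using B by (simp_all add: directed_def)
    then have W: "W = \<Union>B" "scott_open D W" using B is_lub_opens_iff[OF sub(1)] is_lub_carrier[OF B(2)] by auto
    have "dirac D x ` B = (\<lambda>U. indicator U x) ` B"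
      using sub by (intro image_cong) (auto simp: dirac_apply)
    then show ?thesis
      using sub W by (subst is_lub_iff) (auto simp: dirac_apply indicator_def)
  qed
  then have "scont (opens D) (dirac D x)"
    unfolding scott_continuous_def by (auto simp: dirac_apply indicator_def)
  then show ?thesis
    by (auto simp: carrier_V dirac_apply scott_open_Un scott_open_Int scott_open_empty indicator_def)
      (auto simp: dirac_def)
qed

lemma S_eq: "\<S> D = {wsum D {1..n} r (\<lambda>i. dirac D (x i)) | (n::nat) r x.
    (\<forall>i\<in>{1..n}. r i > 0 \<and> x i \<in> carrier D) \<and> sum r {1..n} \<le> 1}"
  by (simp add: \<S>_def wsum_def)

lemma S_wsumE:
  assumes "\<nu> \<in> \<S> D"
  obtains n :: nat and r x where "\<nu> = wsum D {1..n} r (\<lambda>i. dirac D (x i))"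
    "\<And>i. i \<in> {1..n} \<Longrightarrow> 0 \<le> r i" "\<And>i. i \<in> {1..n} \<Longrightarrow> x i \<in> carrier D" "sum r {1..n} \<le> 1"
proof -
  from assms obtain n :: nat and r x where "\<nu> = wsum D {1..n} r (\<lambda>i. dirac D (x i))"
    "\<forall>i\<in>{1..n}. r i > 0 \<and> x i \<in> carrier D" "sum r {1..n} \<le> 1"
    unfolding S_eq by blast
  then show ?thesis by (intro that[of n r x]) (auto intro: less_imp_le)
qed

text \<open>Members of \<S> D have strictly positive weights and are indexed by an initial segment
  of the positive integers. Indices of weight zero are discarded, which changes no sum, and the
  others are enumerated by a bijection.\<close>

lemma wsum_dirac_S:
  fixes r :: "'i \<Rightarrow> real"
  assumes "finite I" "\<And>i. i \<in> I \<Longrightarrow> 0 \<le> r i" "\<And>i. i \<in> I \<Longrightarrow> x i \<in> carrier D" "sum r I \<le> 1"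
  shows "wsum D I r (\<lambda>i. dirac D (x i)) \<in> \<S> D"
proof -
  define J where "J = {i\<in>I. r i \<noteq> 0}"
  have J: "finite J" "J \<subseteq> I" using assms(1) by (auto simp: J_def)
  obtain b where b: "bij_betw b {1..card J} J"
    using ex_bij_betw_nat_finite_1[OF J(1)] by blast
  have bJ: "b i \<in> J" if "i \<in> {1..card J}" for i
    using b that by (auto simp: bij_betw_def)
  have re: "sum f I = (\<Sum>i=1..card J. f (b i))" if "\<And>i. r i = 0 \<Longrightarrow> f i = 0" for f :: "'i \<Rightarrow> real"
  proof -
    have "sum f I = sum f J"
      using assms(1) that by (intro sum.mono_neutral_right) (auto simp: J_def)
    also have "\<dots> = (\<Sum>i=1..card J. f (b i))"
      using sum.reindex_bij_betw[OF b, of f] by simp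
    finally show ?thesis .
  qed
  have "wsum D I r (\<lambda>i. dirac D (x i)) = wsum D {1..card J} (\<lambda>i. r (b i)) (\<lambda>i. dirac D (x (b i)))"
    unfolding wsum_def by (intro restrict_ext re) simp
  moreover have "r (b i) > 0 \<and> x (b i) \<in> carrier D" if "i \<in> {1..card J}" for i
    using bJ[OF that] assms(2,3) by (auto simp: J_def less_le)
  moreover have "(\<Sum>i=1..card J. r (b i)) \<le> 1" using re[of r] assms(4) by simp
  ultimately show ?thesis unfolding S_eq by fastforce
qed

text \<open>A sum of sums of Dirac valuations is a single sum over the pairs \<open>(i, j)\<close>,
  with weights \<open>r i * q i j\<close>. Their total is the sum of the
  \<open>r i * sum (q i) {1..n i}\<close> and so is at most 1.\<close>

lemma wsum_S:
  assumes "finite I" "\<And>i. i \<in> I \<Longrightarrow> 0 \<le> r i" "sum r I \<le> 1" "\<And>i. i \<in> I \<Longrightarrow> \<mu> i \<in> \<S> D"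
  shows "wsum D I r \<mu> \<in> \<S> D"
proof -
  have "\<exists>n q x. \<mu> i = wsum D {1..n::nat} q (\<lambda>j. dirac D (x j)) \<and> (\<forall>j\<in>{1..n}. 0 \<le> q j \<and> x j \<in> carrier D) \<and>
     sum q {1..n} \<le> 1" if "i \<in> I" for i
    using assms(4)[OF that] by (elim S_wsumE) blast
  then obtain n :: "_ \<Rightarrow> nat" and q x where *: "\<And>i. i \<in> I \<Longrightarrow> \<mu> i = wsum D {1..n i} (q i) (\<lambda>j. dirac D (x i j)) \<and>
     (\<forall>j\<in>{1..n i}. 0 \<le> q i j \<and> x i j \<in> carrier D) \<and> sum (q i) {1..n i} \<le> 1"
    by metis
  define K where "K = (SIGMA i:I. {1..n i})"
  have sumK: "sum f K = (\<Sum>i\<in>I. \<Sum>j=1..n i. f (i, j))" for f :: "_ \<Rightarrow> real"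
    unfolding K_def using assms(1) by (subst sum.Sigma) auto
  have "wsum D I r \<mu> = wsum D K (\<lambda>(i,j). r i * q i j) (\<lambda>k. dirac D (case_prod x k))"
    unfolding wsum_def
  proof (intro restrict_ext)
    fix U assume "U \<in> {U. scott_open D U}"
    then show "(\<Sum>i\<in>I. r i * \<mu> i U) = (\<Sum>k\<in>K. (case k of (i, j) \<Rightarrow> r i * q i j) * dirac D (case_prod x k) U)"
      unfolding sumK using * by (auto simp: wsum_apply sum_distrib_left mult.assoc intro!: sum.cong)
  qed
  also have "\<dots> \<in> \<S> D"
  proof (rule wsum_dirac_S)
    have "(\<Sum>(i,j)\<in>K. r i * q i j) = (\<Sum>i\<in>I. r i * sum (q i) {1..n i})"
      unfolding sumK by (simp add: sum_distrib_left)
    also have "\<dots> \<le> 1"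
      using assms(1-3) * by (intro wsum_bounds) (auto intro!: sum_nonneg)
    finally show "(\<Sum>(i,j)\<in>K. r i * q i j) \<le> 1" .
  qed (use assms * in \<open>auto simp: K_def\<close>)
  finally show ?thesis .
qed

section \<open>The least sub-dcpo containing the simple valuations\<close>

lemma S_subset_V: "\<S> D \<subseteq> carrier (\<V> D)"
  by (auto elim!: S_wsumE intro!: wsum_V dirac_V)

lemma carrier_M: "carrier (\<M> D) = \<Inter>{S. sub_dcpo (\<V> D) S \<and> \<S> D \<subseteq> S}"
  and le_M [simp]: "(\<nu> \<sqsubseteq>\<^bsub>\<M> D\<^esub> \<xi>) = (\<forall>U. scott_open D U \<longrightarrow> \<nu> U \<le> \<xi> U)"
  by (simp_all add: \<M>_def flip: le_V)

lemma M_subset_V: "carrier (\<M> D) \<subseteq> carrier (\<V> D)"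
proof -
  have "sub_dcpo (\<V> D) (carrier (\<V> D))" by (auto simp: sub_dcpo_def is_lub_carrier)
  then show ?thesis using S_subset_V[of D] by (auto simp: carrier_M)
qed

lemma M_in_V: "\<nu> \<in> carrier (\<M> D) \<Longrightarrow> \<nu> \<in> carrier (\<V> D)"
  using M_subset_V by blast

lemma S_in_M: "\<nu> \<in> \<S> D \<Longrightarrow> \<nu> \<in> carrier (\<M> D)"
  by (auto simp: carrier_M)

lemma partial_order_M: "partial_order (\<M> D)"
proof (rule partial_orderI)
  fix x y assume "x \<in> carrier (\<M> D)" "y \<in> carrier (\<M> D)" "x \<sqsubseteq>\<^bsub>\<M> D\<^esub> y" "y \<sqsubseteq>\<^bsub>\<M> D\<^esub> x"
  then show "x = y" by (intro V_eqI[of _ D]) (auto intro: order.antisym M_in_V)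
qed (auto simp: \<M>_def \<V>_def intro: order_trans)

lemma mono_into_M_V: "mono_into X A (\<M> D) \<phi> \<Longrightarrow> mono_into X A (\<V> D) \<phi>"
  by (auto simp: mono_into_def Pi_iff M_in_V)

lemma mono_into_id: "A \<subseteq> carrier D \<Longrightarrow> mono_into D A D (\<lambda>x. x)"
  by (auto simp: mono_into_def)

text \<open>The supremum lies in every sub-dcpo that contains the simple valuations, hence in their
  intersection. It stays least in \<M> D, because there are fewer competing upper bounds there than
  in \<V> D.\<close>

lemma M_closed:
  assumes "A \<subseteq> carrier (\<M> D)" "directed (\<V> D) A" "is_lub (\<V> D) A s"
  shows "s \<in> carrier (\<M> D)" "is_lub (\<M> D) A s"
proof -
  show s: "s \<in> carrier (\<M> D)"
    unfolding carrier_M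
  proof
    fix T assume T: "T \<in> {S. sub_dcpo (\<V> D) S \<and> \<S> D \<subseteq> S}"
    then have "A \<subseteq> T" using assms(1) unfolding carrier_M by blast
    then show "s \<in> T" using T assms(2,3) unfolding sub_dcpo_def by blast
  qed
  have "A \<subseteq> carrier (\<V> D)" using assms(1) M_subset_V by blast
  then have "(\<forall>a\<in>A. a \<sqsubseteq>\<^bsub>\<V> D\<^esub> s) \<and> (\<forall>u\<in>carrier (\<V> D). (\<forall>a\<in>A. a \<sqsubseteq>\<^bsub>\<V> D\<^esub> u) \<longrightarrow> s \<sqsubseteq>\<^bsub>\<V> D\<^esub> u)"
    using assms(3) is_lub_iff[of A "\<V> D" s] by metis
  then show "is_lub (\<M> D) A s"
    unfolding is_lub_iff[OF assms(1)] le_M le_V using s M_in_V by blast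
qed

lemma M_limit:
  assumes X: "partial_order X" "directed X A" and \<phi>: "mono_into X A (\<M> D) \<phi>"
    and s: "s \<in> extensional {U. scott_open D U}"
    and lim: "\<And>U. scott_open D U \<Longrightarrow> ((\<lambda>a. \<phi> a U) \<longlongrightarrow> s U) (tails X A)"
  shows "s \<in> carrier (\<M> D)" "is_lub (\<M> D) (\<phi> ` A) s"
proof -
  note V = V_limit[OF X mono_into_M_V[OF \<phi>] s lim]
  have sub: "\<phi> ` A \<subseteq> carrier (\<M> D)" using \<phi> by (auto simp: mono_into_def)
  have "directed (\<V> D) (\<phi> ` A)" by (rule directed_image[OF X(2) mono_into_M_V[OF \<phi>]])
  from M_closed[OF sub this V(2)] show "s \<in> carrier (\<M> D)" "is_lub (\<M> D) (\<phi> ` A) s" by simp_all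
qed

text \<open>Suprema in \<M> D are computed pointwise: the pointwise limit exists and is itself a
  supremum in \<M> D, so it coincides with the given one by uniqueness.\<close>

lemma M_lub_tendsto:
  assumes X: "partial_order X" "directed X A" and \<phi>: "mono_into X A (\<M> D) \<phi>"
    and "is_lub (\<M> D) (\<phi> ` A) s" "scott_open D U"
  shows "((\<lambda>a. \<phi> a U) \<longlongrightarrow> s U) (tails X A)"
proof -
  obtain s' where s': "s' \<in> extensional {U. scott_open D U}"
    "\<And>U. scott_open D U \<Longrightarrow> ((\<lambda>a. \<phi> a U) \<longlongrightarrow> s' U) (tails X A)"
    using V_ex_limit[OF X mono_into_M_V[OF \<phi>]] by blast
  have "s = s'"
    by (rule is_lub_unique[OF partial_order_M _ assms(4) M_limit(2)[OF X \<phi> s']])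
      (use \<phi> in \<open>auto simp: mono_into_def\<close>)
  then show ?thesis using s' assms(5) by simp
qed

lemma dcpo_M: "dcpo (\<M> D)"
  unfolding dcpo_def
proof (intro conjI partial_order_M allI impI)
  fix A assume A: "directed (\<M> D) A"
  then have id: "mono_into (\<M> D) A (\<M> D) (\<lambda>x. x)" by (intro mono_into_id) (simp add: directed_def)
  obtain s where "s \<in> extensional {U. scott_open D U}"
    "\<And>U. scott_open D U \<Longrightarrow> ((\<lambda>\<nu>. \<nu> U) \<longlongrightarrow> s U) (tails (\<M> D) A)"
    using V_ex_limit[OF partial_order_M A mono_into_M_V[OF id]] by blast
  from M_limit(2)[OF partial_order_M A id this] show "\<exists>s. is_lub (\<M> D) A s" by auto
qed

text \<open>Since order and directed suprema in \<M> E are pointwise, continuity can be tested at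
  one open set at a time. Continuity of unit, Kleisli extension and strength thus reduces to
  continuity of real-valued maps.\<close>

lemma scott_continuous_M_iff:
  assumes "partial_order X"
  shows "scott_continuous X (\<M> E) h \<longleftrightarrow>
    h \<in> carrier X \<rightarrow> carrier (\<M> E) \<and> (\<forall>U. scott_open E U \<longrightarrow> scont X (\<lambda>x. h x U))" (is "?L \<longleftrightarrow> ?R")
proof
  assume L: ?L
  note mono = scott_continuous_mono_into[OF L]
  have "scont X (\<lambda>x. h x U)" if U: "scott_open E U" for U
    unfolding scont_iff_tendsto[OF assms]
  proof (intro conjI allI impI)
    show "mono_into X (carrier X) unit_interval_order (\<lambda>x. h x U)"
      by (rule mono_into_V_apply[OF mono_into_M_V[OF mono] U]) simp
    fix A s assume A: "directed X A \<and> is_lub X A s"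
    then have "is_lub (\<M> E) (h ` A) (h s)" using L unfolding scott_continuous_def by blast
    then show "((\<lambda>x. h x U) \<longlongrightarrow> h s U) (tails X A)"
      using A U by (intro M_lub_tendsto[OF assms _ mono]) (auto simp: directed_def)
  qed
  with L show ?R by (simp add: scott_continuous_def)
next
  assume R: ?R
  then have mono: "mono_into X (carrier X) (\<M> E) h"
    unfolding mono_into_def scott_continuous_def by auto
  have "is_lub (\<M> E) (h ` A) (h s)" if A: "directed X A" "is_lub X A s" for A s
  proof (rule M_limit(2)[OF assms A(1)])
    show "mono_into X A (\<M> E) h" using mono A(1) by (auto simp: mono_into_def directed_def Pi_iff subset_iff)
    have "h s \<in> carrier (\<M> E)" using R is_lub_carrier[OF A(2)] by auto
    then show "h s \<in> extensional {U. scott_open E U}" using M_in_V by (auto simp: carrier_V)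
    fix U assume "scott_open E U"
    then show "((\<lambda>x. h x U) \<longlongrightarrow> h s U) (tails X A)"
      using R A unfolding scont_iff_tendsto[OF assms] by blast
  qed
  with mono show ?L by (auto simp: mono_into_def scott_continuous_def)
qed

text \<open>The members of \<M> D with property \<open>P\<close> form a sub-dcpo of \<V> D that
  contains \<S> D, so minimality leaves no others.\<close>

lemma M_induct [consumes 1, case_names simple lub]:
  assumes "\<nu> \<in> carrier (\<M> D)"
    and "\<And>\<nu>. \<nu> \<in> \<S> D \<Longrightarrow> P \<nu>"
    and "\<And>A s. \<lbrakk>directed (\<M> D) A; is_lub (\<M> D) A s; \<And>\<nu>. \<nu> \<in> A \<Longrightarrow> P \<nu>\<rbrakk> \<Longrightarrow> P s"
  shows "P \<nu>"
proof -
  let ?T = "{\<nu> \<in> carrier (\<M> D). P \<nu>}"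
  have "sub_dcpo (\<V> D) ?T"
    unfolding sub_dcpo_def
  proof (intro conjI allI impI)
    show "?T \<subseteq> carrier (\<V> D)" using M_subset_V by blast
    fix A s assume A: "A \<subseteq> ?T \<and> directed (\<V> D) A \<and> is_lub (\<V> D) A s"
    then have dir: "directed (\<M> D) A" by (auto simp: directed_def)
    have sub: "A \<subseteq> carrier (\<M> D)" using A by auto
    have "s \<in> carrier (\<M> D)" "is_lub (\<M> D) A s" using M_closed[OF sub] A by auto
    then show "s \<in> ?T" using assms(3)[OF dir] A by auto
  qed
  moreover have "\<S> D \<subseteq> ?T" using assms(2) S_in_M by auto
  ultimately have "carrier (\<M> D) \<subseteq> ?T" unfolding carrier_M[of D] by blast
  with assms(1) show ?thesis by blast
qed

lemma M_scont_eq: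
  assumes "\<nu> \<in> carrier (\<M> D)" "scont (\<M> D) \<phi>" "scont (\<M> D) \<psi>" "\<And>\<nu>. \<nu> \<in> \<S> D \<Longrightarrow> \<phi> \<nu> = \<psi> \<nu>"
  shows "\<phi> \<nu> = \<psi> \<nu>"
  using assms(1)
proof (induction rule: M_induct)
  case (lub A s)
  note lim = assms(2,3)[unfolded scont_iff_tendsto[OF partial_order_M]]
  have "(\<phi> \<longlongrightarrow> \<psi> s) (tails (\<M> D) A)"
    by (rule Lim_transform_eventually[of \<psi>])
      (use lim lub in \<open>auto intro: eventually_mono[OF eventually_tails_in[OF partial_order_M]]\<close>)
  moreover have "(\<phi> \<longlongrightarrow> \<phi> s) (tails (\<M> D) A)" using lim lub by blast
  ultimately show ?case
    using tendsto_unique[OF tails_ne_bot[OF partial_order_M lub(1)]] by blast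
qed (use assms(4) in auto)

text \<open>The members of the sum are moved from \<open>\<S> D\<close> to \<open>\<M> D\<close> one at a time.\<close>

lemma wsum_M:
  fixes r :: "'i \<Rightarrow> real"
  assumes I: "finite I" "\<And>i. i \<in> I \<Longrightarrow> 0 \<le> r i" "sum r I \<le> 1" "\<And>i. i \<in> I \<Longrightarrow> \<mu> i \<in> carrier (\<M> D)"
  shows "wsum D I r \<mu> \<in> carrier (\<M> D)"
proof -
  \<comment> \<open>\<open>K\<close> holds the indices whose entries may already be arbitrary; the
    remaining entries are simple. The empty \<open>K\<close> is \<open>wsum_S\<close>, and
    \<open>K = I\<close> is the claim.\<close>
  have "wsum D I r \<mu> \<in> carrier (\<M> D)"
    if "finite K" "K \<subseteq> I" "\<And>i. i \<in> K \<Longrightarrow> \<mu> i \<in> carrier (\<M> D)" "\<And>i. i \<in> I - K \<Longrightarrow> \<mu> i \<in> \<S> D" for K and \<mu> :: "'i \<Rightarrow> 'a set \<Rightarrow> real"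
    using that
  proof (induction K arbitrary: \<mu> rule: finite_induct)
    case empty
    then show ?case using I by (intro S_in_M wsum_S) auto
  next
    case (insert k K)
    \<comment> \<open>Only the entry at \<open>k\<close> varies. If it is simple, the outer
      hypothesis applies to the updated family, which is why \<mu> is arbitrary there. The sum is
      continuous in this entry, so directed suprema are covered as well.\<close>
    have "wsum D I r (\<mu>(k := \<nu>)) \<in> carrier (\<M> D)" if "\<nu> \<in> carrier (\<M> D)" for \<nu>
      using that
    proof (induction rule: M_induct)
      case (simple \<nu>)
      then show ?case using insert.hyps insert.prems by (intro insert.IH) auto
    next
      case (lub A s)
      have sub: "A \<subseteq> carrier (\<M> D)" using lub(1) by (simp add: directed_def)
      show ?case
      proof (rule M_limit(1)[OF partial_order_M lub(1)])
        show "mono_into (\<M> D) A (\<M> D) (\<lambda>\<nu>. wsum D I r (\<mu>(k := \<nu>)))"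
          using lub(3) I(2) by (auto simp: mono_into_def wsum_apply simp del: fun_upd_apply intro!: sum_mono mult_left_mono)
            (simp add: fun_upd_def)
        show "wsum D I r (\<mu>(k := s)) \<in> extensional {U. scott_open D U}"
          by (simp add: wsum_def)
        fix U assume U: "scott_open D U"
        have "((\<lambda>\<nu>. (\<mu>(k := \<nu>)) i U) \<longlongrightarrow> (\<mu>(k := s)) i U) (tails (\<M> D) A)" for i
          using M_lub_tendsto[OF partial_order_M lub(1) mono_into_id[OF sub] _ U] lub(2) by simp
        then show "((\<lambda>\<nu>. wsum D I r (\<mu>(k := \<nu>)) U) \<longlongrightarrow> wsum D I r (\<mu>(k := s)) U) (tails (\<M> D) A)"
          unfolding wsum_apply[OF U] by (intro tendsto_sum tendsto_mult tendsto_const)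
      qed
    qed
    from this[of "\<mu> k"] show ?case using insert.prems by simp
  qed
  from this[of I \<mu>] I show ?thesis by simp
qed

section \<open>Integration\<close>

lemma vintegral_cong:
  assumes "\<And>x. x \<in> carrier D \<Longrightarrow> f x = g x"
  shows "vintegral D \<nu> f = vintegral D \<nu> g"
proof -
  have "f -` {t<..1} \<inter> carrier D = g -` {t<..1} \<inter> carrier D" for t
    using assms by auto
  then show ?thesis by (simp add: vintegral_def)
qed

lemma layers_antimono:
  assumes "\<nu> \<in> carrier (\<V> D)" "scont D f"
  shows "antimono_on {0..1} (\<lambda>t. \<nu> (f -` {t<..1} \<inter> carrier D))"
    "(\<lambda>t. \<nu> (f -` {t<..1} \<inter> carrier D)) \<in> {0..1} \<rightarrow> {0..1}"
proof -
  note o = scott_open_vimage_greaterThan[OF assms(2)]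
  show "antimono_on {0..1} (\<lambda>t. \<nu> (f -` {t<..1} \<inter> carrier D))"
    unfolding monotone_on_def by (intro ballI impI V_mono[OF assms(1) o o]) auto
  show "(\<lambda>t. \<nu> (f -` {t<..1} \<inter> carrier D)) \<in> {0..1} \<rightarrow> {0..1}"
    using V_bounds[OF assms(1) o] by auto
qed

lemma layers_integrable:
  assumes "\<nu> \<in> carrier (\<V> D)" "scont D f"
  shows "(\<lambda>t. \<nu> (f -` {t<..1} \<inter> carrier D)) integrable_on {0..1}"
  by (rule antimono_integrable[OF layers_antimono(1)[OF assms]])

lemma vintegral_bounds:
  assumes "\<nu> \<in> carrier (\<V> D)" "scont D f"
  shows "0 \<le> vintegral D \<nu> f" "vintegral D \<nu> f \<le> 1"
proof -
  note b = layers_antimono(2)[OF assms]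
  show "0 \<le> vintegral D \<nu> f" unfolding vintegral_def
    using b by (intro integral_nonneg layers_integrable assms) (auto simp: Pi_iff)
  have "vintegral D \<nu> f \<le> integral {0..1} (\<lambda>_::real. 1::real)" unfolding vintegral_def
    by (rule integral_le[OF layers_integrable[OF assms]]) (use b in \<open>auto simp: Pi_iff\<close>)
  then show "vintegral D \<nu> f \<le> 1" by simp
qed

lemma vintegral_mono:
  assumes "\<nu> \<in> carrier (\<V> D)" "\<xi> \<in> carrier (\<V> D)" "\<nu> \<sqsubseteq>\<^bsub>\<V> D\<^esub> \<xi>"
    "scont D f" "scont D g" "\<And>x. x \<in> carrier D \<Longrightarrow> f x \<le> g x"
  shows "vintegral D \<nu> f \<le> vintegral D \<xi> g"
  unfolding vintegral_def
proof (intro integral_le layers_integrable assms)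
  fix t
  note o = scott_open_vimage_greaterThan
  have "\<nu> (f -` {t<..1} \<inter> carrier D) \<le> \<xi> (f -` {t<..1} \<inter> carrier D)"
    using assms(3) o[OF assms(4)] by simp
  also have "\<dots> \<le> \<xi> (g -` {t<..1} \<inter> carrier D)"
    using assms(6) scontD_bounds(2)[OF assms(5)]
    by (intro V_mono[OF assms(2)] o assms(4,5)) force
  finally show "\<nu> (f -` {t<..1} \<inter> carrier D) \<le> \<xi> (g -` {t<..1} \<inter> carrier D)" .
qed

text \<open>The level sets of \<open>f\<close> do not depend on the index, so pointwise convergence
  of the valuations is pointwise convergence of the antitone functions under the integral.\<close>

lemma vintegral_tendsto_valuation:
  assumes X: "partial_order X" "directed X A" and \<phi>: "mono_into X A (\<V> D) \<phi>"
    and s: "s \<in> carrier (\<V> D)" "\<And>U. scott_open D U \<Longrightarrow> ((\<lambda>a. \<phi> a U) \<longlongrightarrow> s U) (tails X A)"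
    and f: "scont D f"
  shows "((\<lambda>a. vintegral D (\<phi> a) f) \<longlongrightarrow> vintegral D s f) (tails X A)"
  unfolding vintegral_def
proof (intro tendsto_integral_antimono layers_antimono s(1) f s(2) scott_open_vimage_greaterThan)
  show "\<forall>\<^sub>F i in tails X A. antimono_on {0..1} (\<lambda>t. \<phi> i (f -` {t<..1} \<inter> carrier D)) \<and>
      (\<lambda>t. \<phi> i (f -` {t<..1} \<inter> carrier D)) \<in> {0..1} \<rightarrow> {0..1}"
    by (rule eventually_mono[OF eventually_tails_in[OF X]], intro conjI layers_antimono f)
      (use \<phi> in \<open>auto simp: mono_into_def\<close>)
qed

text \<open>Here the level sets grow with the index, and their directed union is the level set of
  \<open>f\<close>. Scott continuity of \<nu> turns this union into a limit of values for each
  \<open>t\<close>.\<close>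

lemma vintegral_tendsto_integrand:
  assumes X: "partial_order X" "directed X A" and \<nu>: "\<nu> \<in> carrier (\<V> D)"
    and F: "\<And>a. a \<in> A \<Longrightarrow> scont D (F a)"
    and mono: "\<And>a b x. \<lbrakk>a \<in> A; b \<in> A; a \<sqsubseteq>\<^bsub>X\<^esub> b; x \<in> carrier D\<rbrakk> \<Longrightarrow> F a x \<le> F b x"
    and f: "scont D f" "\<And>x. x \<in> carrier D \<Longrightarrow> ((\<lambda>a. F a x) \<longlongrightarrow> f x) (tails X A)"
  shows "((\<lambda>a. vintegral D \<nu> (F a)) \<longlongrightarrow> vintegral D \<nu> f) (tails X A)"
  unfolding vintegral_def
proof (intro tendsto_integral_antimono layers_antimono \<nu> f(1))
  show "\<forall>\<^sub>F a in tails X A. antimono_on {0..1} (\<lambda>t. \<nu> (F a -` {t<..1} \<inter> carrier D)) \<and>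
      (\<lambda>t. \<nu> (F a -` {t<..1} \<inter> carrier D)) \<in> {0..1} \<rightarrow> {0..1}"
    by (rule eventually_mono[OF eventually_tails_in[OF X]], intro conjI layers_antimono F \<nu>)
  fix t :: real
  have upper: "F a x \<le> f x" if "a \<in> A" "x \<in> carrier D" for a x
    by (rule tendsto_tails_upper[OF X _ f(2)])
      (use that mono scontD_bounds[OF F] in \<open>auto simp: mono_into_def\<close>)
  \<comment> \<open>Strictness matters: \<open>t < f x\<close> forces \<open>t < F a x\<close> for
    some \<open>a\<close>, whereas a value \<open>t = f x\<close> might be reached by no
    \<open>F a x\<close>.\<close>
  have "(\<Union>a\<in>A. F a -` {t<..1} \<inter> carrier D) = f -` {t<..1} \<inter> carrier D"
  proof (intro equalityI subsetI)
    fix x assume "x \<in> (\<Union>a\<in>A. F a -` {t<..1} \<inter> carrier D)"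
    then show "x \<in> f -` {t<..1} \<inter> carrier D"
      using upper[of _ x] scontD_bounds(2)[OF f(1), of x] by (force intro: less_le_trans)
  next
    fix x assume x: "x \<in> f -` {t<..1} \<inter> carrier D"
    then have "\<forall>\<^sub>F a in tails X A. t < F a x"
      using order_tendstoD(1)[OF f(2)] by auto
    with eventually_tails_in[OF X] have "\<forall>\<^sub>F a in tails X A. a \<in> A \<and> t < F a x"
      by eventually_elim simp
    then obtain a where "a \<in> A" "t < F a x"
      using tails_ne_bot[OF X] by (metis (mono_tags, lifting) eventually_happens)
    then show "x \<in> (\<Union>a\<in>A. F a -` {t<..1} \<inter> carrier D)"
      using x scontD_bounds(2)[OF F] by auto
  qed
  moreover have "mono_into X A (opens D) (\<lambda>a. F a -` {t<..1} \<inter> carrier D)"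
    unfolding mono_into_def
  proof (intro conjI funcsetI ballI impI)
    fix a b assume ab: "a \<in> A" "b \<in> A" "a \<sqsubseteq>\<^bsub>X\<^esub> b"
    show "F a -` {t<..1} \<inter> carrier D \<sqsubseteq>\<^bsub>opens D\<^esub> F b -` {t<..1} \<inter> carrier D"
      using mono[OF ab] scontD_bounds(2)[OF F[OF ab(2)]] by (force intro: less_le_trans)
  qed (simp add: scott_open_vimage_greaterThan F)
  ultimately show "((\<lambda>a. \<nu> (F a -` {t<..1} \<inter> carrier D)) \<longlongrightarrow> \<nu> (f -` {t<..1} \<inter> carrier D)) (tails X A)"
    using V_tendsto_UN[OF X \<nu>] by fastforce
qed

lemma scont_vintegral:
  assumes "scont D f"
  shows "scont (\<M> D) (\<lambda>\<nu>. vintegral D \<nu> f)"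
  unfolding scont_iff_tendsto[OF partial_order_M]
proof (intro conjI allI impI)
  show "mono_into (\<M> D) (carrier (\<M> D)) unit_interval_order (\<lambda>\<nu>. vintegral D \<nu> f)"
    unfolding mono_into_def
  proof (intro conjI funcsetI ballI impI)
    fix \<nu> assume "\<nu> \<in> carrier (\<M> D)"
    then show "vintegral D \<nu> f \<in> carrier unit_interval_order"
      using vintegral_bounds[OF M_in_V assms] by simp
  next
    fix \<nu> \<xi> assume "\<nu> \<in> carrier (\<M> D)" "\<xi> \<in> carrier (\<M> D)" "\<nu> \<sqsubseteq>\<^bsub>\<M> D\<^esub> \<xi>"
    then show "vintegral D \<nu> f \<sqsubseteq>\<^bsub>unit_interval_order\<^esub> vintegral D \<xi> f"
      using vintegral_mono[OF M_in_V M_in_V _ assms assms] by simp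
  qed
  fix A s assume A: "directed (\<M> D) A \<and> is_lub (\<M> D) A s"
  then have id: "mono_into (\<M> D) A (\<M> D) (\<lambda>x. x)" by (intro mono_into_id) (simp add: directed_def)
  show "((\<lambda>\<nu>. vintegral D \<nu> f) \<longlongrightarrow> vintegral D s f) (tails (\<M> D) A)"
  proof (rule vintegral_tendsto_valuation[OF partial_order_M _ mono_into_M_V[OF id] _ _ assms])
    show "s \<in> carrier (\<V> D)" using A is_lub_carrier[of "\<M> D" A s] M_in_V[of s D] by blast
    fix U assume "scott_open D U"
    then show "((\<lambda>\<nu>. \<nu> U) \<longlongrightarrow> s U) (tails (\<M> D) A)"
      using M_lub_tendsto[OF partial_order_M conjunct1[OF A] id _ \<open>scott_open D U\<close>, of s] A by simp
  qed (use A in blast)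
qed

section \<open>Integrals of indicators, integrals against simple valuations, linearity\<close>

lemma vintegral_indicator:
  assumes "scott_open D U" "\<nu> \<in> carrier (\<V> D)"
  shows "vintegral D \<nu> (indicator U) = \<nu> U"
proof -
  have U: "U \<subseteq> carrier D" using assms(1) by (simp add: scott_open_def)
  have "vintegral D \<nu> (indicator U) = integral {0..1} (\<lambda>_::real. \<nu> U)"
    unfolding vintegral_def
  \<comment> \<open>For \<open>t < 1\<close> the level set is \<open>U\<close>; at
    \<open>t = 1\<close> it is empty, so that single point is removed.\<close>
  proof (rule integral_spike[where S = "{1}"])
    fix t :: real assume "t \<in> {0..1} - {1}"
    then have "(indicator U :: 'a \<Rightarrow> real) -` {t<..1} \<inter> carrier D = U"
      using U by (auto simp: indicator_def of_bool_def split: if_splits)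
    then show "\<nu> U = \<nu> ((indicator U :: 'a \<Rightarrow> real) -` {t<..1} \<inter> carrier D)" by simp
  qed simp
  then show ?thesis by simp
qed

lemma vintegral_dirac:
  assumes "x \<in> carrier D" "scont D f"
  shows "vintegral D (dirac D x) f = f x"
proof -
  note b = scontD_bounds[OF assms(2,1)]
  have "vintegral D (dirac D x) f = integral {0..1} (indicator {0..f x})"
    unfolding vintegral_def
  \<comment> \<open>The Dirac valuation of the level set is 1 exactly for \<open>t < f x\<close>, so
    it differs from the indicator of the closed interval only at \<open>f x\<close>.\<close>
  proof (rule integral_spike[where S = "{f x}"])
    fix t assume "t \<in> {0..1} - {f x}"
    then show "indicator {0..f x} t = dirac D x (f -` {t<..1} \<inter> carrier D)"
      using assms(1) b by (auto simp: dirac_apply[OF scott_open_vimage_greaterThan[OF assms(2)]] indicator_def)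
  qed simp
  also have "\<dots> = integral {0..f x} (\<lambda>_. 1)"
    using b by (subst integral_indicator) (auto simp: Int_absorb1)
  finally show ?thesis using b by simp
qed

text \<open>The level sets depend on \<open>f\<close> alone, so this is linearity of the Riemann
  integral.\<close>

lemma vintegral_wsum:
  assumes "finite I" "\<And>i. i \<in> I \<Longrightarrow> \<mu> i \<in> carrier (\<V> D)" "scont D f"
  shows "vintegral D (wsum D I r \<mu>) f = (\<Sum>i\<in>I. r i * vintegral D (\<mu> i) f)"
  unfolding vintegral_def wsum_apply[OF scott_open_vimage_greaterThan[OF assms(3)]]
  using assms by (subst integral_sum) (auto intro!: integrable_on_mult_right layers_integrable)

lemma vintegral_wsum_dirac:
  assumes "finite I" "\<And>i. i \<in> I \<Longrightarrow> x i \<in> carrier D" "scont D f"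
  shows "vintegral D (wsum D I r (\<lambda>i. dirac D (x i))) f = (\<Sum>i\<in>I. r i * f (x i))"
  using assms by (simp add: vintegral_wsum dirac_V vintegral_dirac)

text \<open>The level sets of a sum are not simply related to those of its summands. For simple
  \<nu>, however, integration is a finite sum and the claim is an interchange of two finite sums;
  both sides are Scott-continuous in \<nu>.\<close>

lemma vintegral_sum:
  assumes D: "partial_order D" and \<nu>: "\<nu> \<in> carrier (\<M> D)" and "finite I"
    and r: "\<And>i. i \<in> I \<Longrightarrow> 0 \<le> r i" "sum r I \<le> 1" and f: "\<And>i. i \<in> I \<Longrightarrow> scont D (f i)"
  shows "vintegral D \<nu> (\<lambda>x. \<Sum>i\<in>I. r i * f i x) = (\<Sum>i\<in>I. r i * vintegral D \<nu> (f i))"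
  using \<nu>
proof (rule M_scont_eq)
  have sc: "scont D (\<lambda>x. \<Sum>i\<in>I. r i * f i x)" by (intro scont_wsum D r f)
  then show "scont (\<M> D) (\<lambda>\<nu>. vintegral D \<nu> (\<lambda>x. \<Sum>i\<in>I. r i * f i x))"
    by (rule scont_vintegral)
  show "scont (\<M> D) (\<lambda>\<nu>. \<Sum>i\<in>I. r i * vintegral D \<nu> (f i))"
    by (intro scont_wsum partial_order_M r scont_vintegral f)
  fix \<nu> assume "\<nu> \<in> \<S> D"
  then obtain n :: nat and q x where \<nu>: "\<nu> = wsum D {1..n} q (\<lambda>i. dirac D (x i))" "\<And>i. i \<in> {1..n} \<Longrightarrow> x i \<in> carrier D"
    by (metis S_wsumE)
  show "vintegral D \<nu> (\<lambda>x. \<Sum>i\<in>I. r i * f i x) = (\<Sum>i\<in>I. r i * vintegral D \<nu> (f i))"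
  proof -
    have eq: "vintegral D \<nu> g = (\<Sum>j=1..n. q j * g (x j))" if "scont D g" for g
      unfolding \<nu>(1) using \<nu>(2) that by (intro vintegral_wsum_dirac) auto
    have "vintegral D \<nu> (\<lambda>x. \<Sum>i\<in>I. r i * f i x) = (\<Sum>i\<in>I. \<Sum>j=1..n. r i * (q j * f i (x j)))"
      unfolding eq[OF sc] sum_distrib_left by (subst sum.swap) (simp add: mult.left_commute)
    also have "\<dots> = (\<Sum>i\<in>I. r i * vintegral D \<nu> (f i))"
      by (intro sum.cong refl) (simp only: eq f sum_distrib_left)
    finally show ?thesis .
  qed
qed

section \<open>Products\<close>

lemma carrier_prod [simp]: "carrier (D \<times>\<^sub>D E) = carrier D \<times> carrier E"
  and le_prod [simp]: "((x, y) \<sqsubseteq>\<^bsub>D \<times>\<^sub>D E\<^esub> (x', y')) = (x \<sqsubseteq>\<^bsub>D\<^esub> x' \<and> y \<sqsubseteq>\<^bsub>E\<^esub> y')"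
  by (simp_all add: prod_order_def)

lemma le_prod_iff: "(p \<sqsubseteq>\<^bsub>D \<times>\<^sub>D E\<^esub> q) = (fst p \<sqsubseteq>\<^bsub>D\<^esub> fst q \<and> snd p \<sqsubseteq>\<^bsub>E\<^esub> snd q)"
  by (simp add: prod_order_def)

lemma partial_order_prod:
  assumes "partial_order D" "partial_order E"
  shows "partial_order (D \<times>\<^sub>D E)"
proof (rule partial_orderI)
  show "eq (D \<times>\<^sub>D E) = (=)" by (simp add: prod_order_def)
qed (auto simp: le_prod_iff intro: assms[THEN partial_order_refl] assms[THEN partial_order_trans] assms[THEN partial_order_antisym])

lemma directed_fst: "directed (D \<times>\<^sub>D E) A \<Longrightarrow> directed D (fst ` A)"
  and directed_snd: "directed (D \<times>\<^sub>D E) A \<Longrightarrow> directed E (snd ` A)"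
  by (rule directed_image, assumption, force simp: mono_into_def directed_def)+

lemma is_lub_prod:
  assumes "A \<subseteq> carrier (D \<times>\<^sub>D E)"
  shows "is_lub (D \<times>\<^sub>D E) A (s, t) \<longleftrightarrow> is_lub D (fst ` A) s \<and> is_lub E (snd ` A) t"
proof -
  have sub: "fst ` A \<subseteq> carrier D" "snd ` A \<subseteq> carrier E" using assms by auto
  show ?thesis
  proof
    assume "is_lub (D \<times>\<^sub>D E) A (s, t)"
    then have st: "s \<in> carrier D" "t \<in> carrier E" "\<forall>p\<in>A. fst p \<sqsubseteq>\<^bsub>D\<^esub> s \<and> snd p \<sqsubseteq>\<^bsub>E\<^esub> t"
      "\<And>u v. \<lbrakk>u \<in> carrier D; v \<in> carrier E; \<forall>p\<in>A. fst p \<sqsubseteq>\<^bsub>D\<^esub> u \<and> snd p \<sqsubseteq>\<^bsub>E\<^esub> v\<rbrakk> \<Longrightarrow> s \<sqsubseteq>\<^bsub>D\<^esub> u \<and> t \<sqsubseteq>\<^bsub>E\<^esub> v"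
      unfolding is_lub_iff[OF assms] by (auto simp: le_prod_iff)
    then show "is_lub D (fst ` A) s \<and> is_lub E (snd ` A) t"
      unfolding is_lub_iff[OF sub(1)] is_lub_iff[OF sub(2)] ball_simps by blast
  next
    assume "is_lub D (fst ` A) s \<and> is_lub E (snd ` A) t"
    then show "is_lub (D \<times>\<^sub>D E) A (s, t)"
      unfolding is_lub_iff[OF sub(1)] is_lub_iff[OF sub(2)] is_lub_iff[OF assms]
      by (auto simp: le_prod_iff)
  qed
qed

lemma is_lub_singleton: "partial_order D \<Longrightarrow> x \<in> carrier D \<Longrightarrow> is_lub D {x} x"
  by (subst is_lub_iff) (auto intro: partial_order_refl)

lemma scott_continuous_prodI:
  assumes "scott_continuous X D f" "scott_continuous X E g"
  shows "scott_continuous X (D \<times>\<^sub>D E) (\<lambda>x. (f x, g x))"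
proof -
  have "is_lub (D \<times>\<^sub>D E) ((\<lambda>x. (f x, g x)) ` A) (f s, g s)" if A: "directed X A" "is_lub X A s" for A s
  proof (subst is_lub_prod)
    show "(\<lambda>x. (f x, g x)) ` A \<subseteq> carrier (D \<times>\<^sub>D E)"
      using A(1) assms by (auto simp: directed_def scott_continuous_def)
    show "is_lub D (fst ` (\<lambda>x. (f x, g x)) ` A) (f s) \<and> is_lub E (snd ` (\<lambda>x. (f x, g x)) ` A) (g s)"
      using A assms by (simp add: image_image scott_continuous_def)
  qed
  then show ?thesis using assms by (auto simp: scott_continuous_def)
qed

lemma scott_continuous_const:
  assumes "partial_order E" "c \<in> carrier E"
  shows "scott_continuous X E (\<lambda>_. c)"
proof -
  have "(\<lambda>_. c) ` A = {c}" if "directed X A" for A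
    using that by (auto simp: directed_def)
  then show ?thesis
    using assms by (auto simp: scott_continuous_def intro: partial_order_refl is_lub_singleton)
qed

lemma scott_continuous_fst: "scott_continuous (D \<times>\<^sub>D E) D fst"
  and scott_continuous_snd: "scott_continuous (D \<times>\<^sub>D E) E snd"
  using is_lub_prod[of _ D E] by (auto simp: scott_continuous_def directed_def)

lemma scott_continuous_Pair1:
  "partial_order E \<Longrightarrow> y \<in> carrier E \<Longrightarrow> scott_continuous D (D \<times>\<^sub>D E) (\<lambda>x. (x, y))"
  and scott_continuous_Pair2:
  "partial_order D \<Longrightarrow> x \<in> carrier D \<Longrightarrow> scott_continuous E (D \<times>\<^sub>D E) (\<lambda>y. (x, y))"
  by (intro scott_continuous_prodI scott_continuous_id scott_continuous_const; assumption)+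

text \<open>For a directed \<open>A\<close> in the product, every \<open>(fst p, snd q)\<close> with
  \<open>p\<close> and \<open>q\<close> in \<open>A\<close> lies below a member of \<open>A\<close>.
  The supremum over \<open>A\<close> is therefore an iterated supremum over the two projections, and
  the separate continuities apply one after the other.\<close>

lemma scont_prodI:
  assumes 1: "\<And>y. y \<in> carrier E \<Longrightarrow> scont D (\<lambda>x. f (x, y))"
    and 2: "\<And>x. x \<in> carrier D \<Longrightarrow> scont E (\<lambda>y. f (x, y))"
  shows "scont (D \<times>\<^sub>D E) f"
proof -
  have bounds: "0 \<le> f (x, y) \<and> f (x, y) \<le> 1" if "x \<in> carrier D" "y \<in> carrier E" for x y
    using scontD_bounds[OF 1[OF that(2)] that(1)] by simp
  have mono: "f (x, y) \<le> f (x', y')"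
    if "x \<sqsubseteq>\<^bsub>D\<^esub> x'" "y \<sqsubseteq>\<^bsub>E\<^esub> y'" "x \<in> carrier D" "x' \<in> carrier D" "y \<in> carrier E" "y' \<in> carrier E" for x x' y y'
  proof -
    have "f (x, y) \<le> f (x', y)" using 1[of y] that by (simp add: scott_continuous_def)
    also have "\<dots> \<le> f (x', y')" using 2[of x'] that by (simp add: scott_continuous_def)
    finally show ?thesis .
  qed
  have "is_lub unit_interval_order (f ` A) (f (s, t))"
    if A: "directed (D \<times>\<^sub>D E) A" "is_lub (D \<times>\<^sub>D E) A (s, t)" for A s t
  proof -
    have sub: "A \<subseteq> carrier D \<times> carrier E" "A \<noteq> {}" using A(1) by (auto simp: directed_def)
    have lubs: "is_lub D (fst ` A) s" "is_lub E (snd ` A) t"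
      using is_lub_prod[of A D E] A sub by auto
    have st: "s \<in> carrier D" "t \<in> carrier E" using is_lub_carrier[OF lubs(1)] is_lub_carrier[OF lubs(2)] by simp_all
    have up: "\<forall>p\<in>A. fst p \<sqsubseteq>\<^bsub>D\<^esub> s \<and> snd p \<sqsubseteq>\<^bsub>E\<^esub> t"
      using A(2) sub by (subst (asm) is_lub_iff) (auto simp: le_prod_iff)
    have "f (s, t) \<le> u" if u: "u \<in> {0..1}" "\<forall>p\<in>A. f p \<le> u" for u
    proof -
      \<comment> \<open>The coordinates come from different members; a common upper bound
        \<open>c\<close> in \<open>A\<close> repairs this. Next the second coordinate is sent to its
        supremum \<open>t\<close>, then the first to \<open>s\<close>.\<close>
      have pq: "f (fst p, snd q) \<le> u" if pqA: "p \<in> A" "q \<in> A" for p q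
      proof -
        obtain c where c: "c \<in> A" "p \<sqsubseteq>\<^bsub>D \<times>\<^sub>D E\<^esub> c" "q \<sqsubseteq>\<^bsub>D \<times>\<^sub>D E\<^esub> c"
          using A(1) pqA unfolding directed_def by blast
        have "p \<in> carrier D \<times> carrier E" "q \<in> carrier D \<times> carrier E" "c \<in> carrier D \<times> carrier E"
          using sub pqA c(1) by blast+
        then have "f (fst p, snd q) \<le> f (fst c, snd c)"
          using c(2,3) unfolding le_prod_iff mem_Times_iff by (intro mono) simp_all
        also have "\<dots> \<le> u" using u(2) c(1) by simp
        finally show ?thesis .
      qed
      have pt: "f (fst p, t) \<le> u" if "p \<in> A" for p
      proof -
        have p: "fst p \<in> carrier D" using that sub by auto
        have "is_lub unit_interval_order ((\<lambda>y. f (fst p, y)) ` snd ` A) (f (fst p, t))"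
          using 2[OF p] directed_snd[OF A(1)] lubs(2) unfolding scott_continuous_def by blast
        moreover have "(\<lambda>y. f (fst p, y)) ` snd ` A \<subseteq> {0..1}"
          using sub bounds[OF p] by auto
        ultimately show ?thesis using pq[OF that] u(1) by (simp add: is_lub_iff)
      qed
      have "is_lub unit_interval_order ((\<lambda>x. f (x, t)) ` fst ` A) (f (s, t))"
        using 1[OF st(2)] directed_fst[OF A(1)] lubs(1) unfolding scott_continuous_def by blast
      moreover have "(\<lambda>x. f (x, t)) ` fst ` A \<subseteq> {0..1}"
        using sub bounds[OF _ st(2)] by auto
      ultimately show ?thesis using pt u(1) by (simp add: is_lub_iff)
    qed
    moreover have "f p \<le> f (s, t)" if "p \<in> A" for p
      using mono[of "fst p" s "snd p" t] up that sub st by auto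
    moreover have "f ` A \<subseteq> {0..1}"
    proof safe
      fix x y assume "(x, y) \<in> A"
      then show "f (x, y) \<in> {0..1}" using sub bounds[of x y] by auto
    qed
    ultimately show ?thesis using bounds[OF st] by (simp add: is_lub_iff)
  qed
  then show ?thesis
    using bounds mono unfolding scott_continuous_def by auto
qed

lemma scont_slice1:
  assumes "partial_order E" "scont (D \<times>\<^sub>D E) f" "y \<in> carrier E"
  shows "scont D (\<lambda>x. f (x, y))"
  by (rule scott_continuous_compose[OF scott_continuous_Pair1[OF assms(1,3)] assms(2)])

lemma scont_slice2:
  assumes "partial_order D" "scont (D \<times>\<^sub>D E) f" "x \<in> carrier D"
  shows "scont E (\<lambda>y. f (x, y))"
  by (rule scott_continuous_compose[OF scott_continuous_Pair2[OF assms(1,3)] assms(2)])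

text \<open>This makes the outer integral of an iterated integral meaningful: along a directed set
  of parameters \<open>x\<close> the slices increase to the slice at the supremum, and the limit
  theorem for integrands applies.\<close>

lemma scont_vintegral_slice:
  assumes po: "partial_order D" "partial_order E"
    and f: "scont (D \<times>\<^sub>D E) f" and \<nu>: "\<nu> \<in> carrier (\<V> E)"
  shows "scont D (\<lambda>x. vintegral E \<nu> (\<lambda>y. f (x, y)))"
  unfolding scont_iff_tendsto[OF po(1)]
proof (intro conjI allI impI)
  note s1 = scont_slice1[OF po(2) f] and s2 = scont_slice2[OF po(1) f]
  have mono: "f (x, y) \<le> f (x', y)" if "x \<sqsubseteq>\<^bsub>D\<^esub> x'" "x \<in> carrier D" "x' \<in> carrier D" "y \<in> carrier E" for x x' y
    using s1[of y] that by (simp add: scott_continuous_def)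
  then show "mono_into D (carrier D) unit_interval_order (\<lambda>x. vintegral E \<nu> (\<lambda>y. f (x, y)))"
    using vintegral_bounds[OF \<nu> s2] vintegral_mono[OF \<nu> \<nu> partial_order_refl[OF partial_order_V \<nu>] s2 s2]
    by (simp add: mono_into_def)
  fix A s assume A: "directed D A \<and> is_lub D A s"
  then have sub: "A \<subseteq> carrier D" "s \<in> carrier D" by (auto simp: directed_def intro: is_lub_carrier)
  show "((\<lambda>x. vintegral E \<nu> (\<lambda>y. f (x, y))) \<longlongrightarrow> vintegral E \<nu> (\<lambda>y. f (s, y))) (tails D A)"
  proof (rule vintegral_tendsto_integrand[OF po(1) _ \<nu>])
    fix y assume "y \<in> carrier E"
    then show "((\<lambda>x. f (x, y)) \<longlongrightarrow> f (s, y)) (tails D A)"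
      using s1[of y] A unfolding scont_iff_tendsto[OF po(1)] by blast
  qed (use A sub s2 mono in \<open>auto simp: subset_iff\<close>)
qed

section \<open>The monad\<close>

lemma dirac_M:
  assumes "x \<in> carrier D"
  shows "dirac D x \<in> carrier (\<M> D)"
proof -
  have "wsum D {()} (\<lambda>_. 1) (\<lambda>_. dirac D x) \<in> \<S> D"
    using assms by (intro wsum_dirac_S) auto
  moreover have "wsum D {()} (\<lambda>_. 1) (\<lambda>_. dirac D x) = dirac D x"
    by (auto simp: wsum_def dirac_def)
  ultimately show ?thesis using S_in_M by metis
qed

lemma scott_continuous_dirac:
  assumes "partial_order D"
  shows "scott_continuous D (\<M> D) (dirac D)"
  unfolding scott_continuous_M_iff[OF assms]
  by (auto simp: dirac_M dirac_apply intro: scont_indicator)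

lemma kleisli_apply: "scott_open E U \<Longrightarrow> kleisli D E f \<nu> U = vintegral D \<nu> (\<lambda>x. f x U)"
  by (simp add: kleisli_def)

lemma scont_apply:
  "\<lbrakk>partial_order D; scott_continuous D (\<M> E) f; scott_open E U\<rbrakk> \<Longrightarrow> scont D (\<lambda>x. f x U)"
  by (simp add: scott_continuous_M_iff)

lemma kleisli_wsum_dirac:
  assumes "partial_order D" "scott_continuous D (\<M> E) f" "finite I" "\<And>i. i \<in> I \<Longrightarrow> x i \<in> carrier D"
  shows "kleisli D E f (wsum D I r (\<lambda>i. dirac D (x i))) = wsum E I r (\<lambda>i. f (x i))"
  using vintegral_wsum_dirac[OF assms(3,4) scont_apply[OF assms(1,2)]]
  by (auto simp: kleisli_def wsum_def)

text \<open>A simple valuation is sent to a weighted sum of the \<open>f (x i)\<close>, which are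
  members of \<M> E but in general not simple; \<open>wsum_M\<close> covers exactly this case.
  Directed suprema are preserved because the value at each open set is Scott-continuous in
  \<nu>.\<close>

lemma kleisli_M:
  assumes D: "partial_order D" and f: "scott_continuous D (\<M> E) f" and "\<nu> \<in> carrier (\<M> D)"
  shows "kleisli D E f \<nu> \<in> carrier (\<M> E)"
  using assms(3)
proof (induction rule: M_induct)
  case (simple \<nu>)
  obtain n :: nat and r x where \<nu>: "\<nu> = wsum D {1..n} r (\<lambda>i. dirac D (x i))"
    "\<And>i. i \<in> {1..n} \<Longrightarrow> 0 \<le> r i" "\<And>i. i \<in> {1..n} \<Longrightarrow> x i \<in> carrier D" "sum r {1..n} \<le> 1"
    using S_wsumE[OF simple] by metis
  have "wsum E {1..n} r (\<lambda>i. f (x i)) \<in> carrier (\<M> E)"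
    using \<nu>(3) f by (intro wsum_M \<nu>(2,4)) (auto simp: scott_continuous_def)
  then show ?case
    using kleisli_wsum_dirac[OF D f finite_atLeastAtMost \<nu>(3), where r = r] \<nu>(1) by simp
next
  case (lub A s)
  have sub: "A \<subseteq> carrier (\<M> D)" using lub(1) by (simp add: directed_def)
  note sc = scont_vintegral[OF scont_apply[OF D f]]
  show ?case
  proof (rule M_limit(1)[OF partial_order_M lub(1)])
    show "mono_into (\<M> D) A (\<M> E) (kleisli D E f)"
      using lub(3) scott_continuous_mono_into[OF sc sub]
      by (auto simp: mono_into_def kleisli_apply)
    show "kleisli D E f s \<in> extensional {U. scott_open E U}" by (simp add: kleisli_def)
    fix U assume U: "scott_open E U"
    show "((\<lambda>\<nu>. kleisli D E f \<nu> U) \<longlongrightarrow> kleisli D E f s U) (tails (\<M> D) A)"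
      using sc[OF U] lub(1,2) unfolding kleisli_apply[OF U] scont_iff_tendsto[OF partial_order_M] by blast
  qed
qed

lemma scott_continuous_kleisli:
  assumes "partial_order D" "scott_continuous D (\<M> E) f"
  shows "scott_continuous (\<M> D) (\<M> E) (kleisli D E f)"
  unfolding scott_continuous_M_iff[OF partial_order_M]
  using kleisli_M[OF assms] scont_vintegral[OF scont_apply[OF assms]] by (simp add: kleisli_apply)

text \<open>For simple \<nu> both sides equal the sum of
  \<open>r i * vintegral E (f (x i)) h\<close>: on the left by linearity in the valuation, on the
  right by integrating against Dirac valuations.\<close>

lemma vintegral_kleisli:
  assumes D: "partial_order D" and f: "scott_continuous D (\<M> E) f"
    and \<nu>: "\<nu> \<in> carrier (\<M> D)" and h: "scont E h"
  shows "vintegral E (kleisli D E f \<nu>) h = vintegral D \<nu> (\<lambda>x. vintegral E (f x) h)"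
  using \<nu>
proof (rule M_scont_eq)
  show "scont (\<M> D) (\<lambda>\<nu>. vintegral E (kleisli D E f \<nu>) h)"
    by (rule scott_continuous_compose[OF scott_continuous_kleisli[OF D f] scont_vintegral[OF h]])
  have sc: "scont D (\<lambda>x. vintegral E (f x) h)"
    by (rule scott_continuous_compose[OF f scont_vintegral[OF h]])
  then show "scont (\<M> D) (\<lambda>\<nu>. vintegral D \<nu> (\<lambda>x. vintegral E (f x) h))"
    by (rule scont_vintegral)
  fix \<nu> assume "\<nu> \<in> \<S> D"
  then obtain n :: nat and r x where \<nu>: "\<nu> = wsum D {1..n} r (\<lambda>i. dirac D (x i))"
    "\<And>i. i \<in> {1..n} \<Longrightarrow> x i \<in> carrier D"
    by (metis S_wsumE)
  have fx: "f (x i) \<in> carrier (\<V> E)" if "i \<in> {1..n}" for i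
    using f \<nu>(2)[OF that] by (auto simp: scott_continuous_def intro: M_in_V)
  have "vintegral E (kleisli D E f \<nu>) h = vintegral E (wsum E {1..n} r (\<lambda>i. f (x i))) h"
    unfolding \<nu>(1) using kleisli_wsum_dirac[OF D f finite_atLeastAtMost \<nu>(2), where r = r] by simp
  also have "\<dots> = (\<Sum>i=1..n. r i * vintegral E (f (x i)) h)"
    by (rule vintegral_wsum[OF _ fx h]) simp_all
  also have "\<dots> = vintegral D \<nu> (\<lambda>x. vintegral E (f x) h)"
    unfolding \<nu>(1) using vintegral_wsum_dirac[OF finite_atLeastAtMost \<nu>(2) sc, where r = r] by simp
  finally show "vintegral E (kleisli D E f \<nu>) h = vintegral D \<nu> (\<lambda>x. vintegral E (f x) h)" .
qed

text \<open>The indicator of an open set is an admissible test function, and its integral returns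
  the value of the valuation at that set.\<close>

lemma M_eqI:
  assumes "\<mu> \<in> carrier (\<M> D)" "\<nu> \<in> carrier (\<M> D)" "\<And>h. scont D h \<Longrightarrow> vintegral D \<mu> h = vintegral D \<nu> h"
  shows "\<mu> = \<nu>"
proof (rule V_eqI[OF M_in_V[OF assms(1)] M_in_V[OF assms(2)]])
  fix U assume U: "scott_open D U"
  show "\<mu> U = \<nu> U"
    using assms(3)[OF scont_indicator[OF U]] vintegral_indicator[OF U] assms(1,2) M_in_V by metis
qed

section \<open>Pushforward along Scott-continuous maps, and multiplication\<close>

lemma scott_continuous_dirac_comp:
  assumes "partial_order E" "scott_continuous D E k"
  shows "scott_continuous D (\<M> E) (\<lambda>x. dirac E (k x))"
  by (rule scott_continuous_compose[OF assms(2) scott_continuous_dirac[OF assms(1)]])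

lemma scott_continuous_fmap:
  assumes "partial_order D" "partial_order E" "scott_continuous D E k"
  shows "scott_continuous (\<M> D) (\<M> E) (fmap D E k)"
  unfolding fmap_def by (intro scott_continuous_kleisli scott_continuous_dirac_comp assms)

lemma fmap_M:
  assumes "partial_order D" "partial_order E" "scott_continuous D E k" "\<nu> \<in> carrier (\<M> D)"
  shows "fmap D E k \<nu> \<in> carrier (\<M> E)"
  using scott_continuous_fmap[OF assms(1-3)] assms(4) by (auto simp: scott_continuous_def)

lemma vintegral_fmap:
  assumes "partial_order D" "partial_order E" "scott_continuous D E k" "\<nu> \<in> carrier (\<M> D)" "scont E h"
  shows "vintegral E (fmap D E k \<nu>) h = vintegral D \<nu> (\<lambda>x. h (k x))"
proof -
  have "vintegral E (fmap D E k \<nu>) h = vintegral D \<nu> (\<lambda>x. vintegral E (dirac E (k x)) h)"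
    unfolding fmap_def by (intro vintegral_kleisli scott_continuous_dirac_comp assms)
  also have "\<dots> = vintegral D \<nu> (\<lambda>x. h (k x))"
    using assms(3,5) by (intro vintegral_cong vintegral_dirac) (auto simp: scott_continuous_def)
  finally show ?thesis .
qed

lemma kl_mult_M: "\<Phi> \<in> carrier (\<M> (\<M> D)) \<Longrightarrow> kl_mult D \<Phi> \<in> carrier (\<M> D)"
  unfolding kl_mult_def by (intro kleisli_M partial_order_M scott_continuous_id)

lemma vintegral_kl_mult:
  "\<Phi> \<in> carrier (\<M> (\<M> D)) \<Longrightarrow> scont D h \<Longrightarrow>
    vintegral D (kl_mult D \<Phi>) h = vintegral (\<M> D) \<Phi> (\<lambda>\<nu>. vintegral D \<nu> h)"
  unfolding kl_mult_def by (intro vintegral_kleisli partial_order_M scott_continuous_id)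

section \<open>The strength\<close>

text \<open>For fixed \<open>a\<close> the strength is the pushforward along the slice inclusion,
  because the indicator of \<open>U\<close> at \<open>(a, y)\<close> is the Dirac valuation at
  \<open>(a, y)\<close> of \<open>U\<close>. Its membership in \<M> and its integrals are inherited
  from \<open>fmap\<close>.\<close>

lemma strength_eq_fmap: "strength D E (a, \<nu>) = fmap E (D \<times>\<^sub>D E) (\<lambda>y. (a, y)) \<nu>"
  unfolding fmap_def kleisli_def strength_def by (auto simp: dirac_apply)

lemma strength_M:
  assumes "partial_order D" "partial_order E" "a \<in> carrier D" "\<nu> \<in> carrier (\<M> E)"
  shows "strength D E (a, \<nu>) \<in> carrier (\<M> (D \<times>\<^sub>D E))"
  unfolding strength_eq_fmap by (intro fmap_M partial_order_prod scott_continuous_Pair2 assms)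

lemma vintegral_strength:
  assumes "partial_order D" "partial_order E" "a \<in> carrier D" "\<nu> \<in> carrier (\<M> E)" "scont (D \<times>\<^sub>D E) h"
  shows "vintegral (D \<times>\<^sub>D E) (strength D E (a, \<nu>)) h = vintegral E \<nu> (\<lambda>y. h (a, y))"
  unfolding strength_eq_fmap by (intro vintegral_fmap partial_order_prod scott_continuous_Pair2 assms)

text \<open>Moving \<open>x\<close> varies only the integrand and moving \<nu> only the valuation,
  so the two limit theorems give separate continuity and \<open>scont_prodI\<close> joins them.
  Continuity of the strength and Fubini both rest on this.\<close>

lemma scont_vintegral_joint:
  assumes po: "partial_order D" "partial_order E" and f: "scont (D \<times>\<^sub>D E) f"
  shows "scont (D \<times>\<^sub>D \<M> E) (\<lambda>p. vintegral E (snd p) (\<lambda>y. f (fst p, y)))"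
proof (rule scont_prodI)
  fix \<nu> assume "\<nu> \<in> carrier (\<M> E)"
  then show "scont D (\<lambda>x. vintegral E (snd (x, \<nu>)) (\<lambda>y. f (fst (x, \<nu>), y)))"
    using scont_vintegral_slice[OF po f M_in_V] by simp
next
  fix x assume "x \<in> carrier D"
  then show "scont (\<M> E) (\<lambda>\<nu>. vintegral E (snd (x, \<nu>)) (\<lambda>y. f (fst (x, \<nu>), y)))"
    using scont_vintegral[OF scont_slice2[OF po(1) f]] by simp
qed

lemma scott_continuous_strength:
  assumes po: "partial_order D" "partial_order E"
  shows "scott_continuous (D \<times>\<^sub>D \<M> E) (\<M> (D \<times>\<^sub>D E)) (strength D E)"
  unfolding scott_continuous_M_iff[OF partial_order_prod[OF po(1) partial_order_M]]
proof (intro conjI allI impI)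
  show "strength D E \<in> carrier (D \<times>\<^sub>D \<M> E) \<rightarrow> carrier (\<M> (D \<times>\<^sub>D E))"
    using strength_M[OF po] by auto
  fix U assume U: "scott_open (D \<times>\<^sub>D E) U"
  have "strength D E p U = vintegral E (snd p) (\<lambda>y. indicator U (fst p, y))" for p
    using U by (cases p) (simp add: strength_def)
  then show "scont (D \<times>\<^sub>D \<M> E) (\<lambda>p. strength D E p U)"
    using scont_vintegral_joint[OF po scont_indicator[OF U]] by simp
qed

section \<open>Structural maps of products, costrength and Fubini\<close>

lemma scott_continuous_swap: "scott_continuous (D \<times>\<^sub>D E) (E \<times>\<^sub>D D) prod.swap"
  using scott_continuous_prodI[OF scott_continuous_snd[of D E] scott_continuous_fst[of D E]]
  by (simp add: prod.swap_def[abs_def])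

lemma scott_continuous_map_prod:
  assumes "scott_continuous D F h" "scott_continuous E G k"
  shows "scott_continuous (D \<times>\<^sub>D E) (F \<times>\<^sub>D G) (map_prod h k)"
  using scott_continuous_prodI[OF scott_continuous_compose[OF scott_continuous_fst assms(1)]
      scott_continuous_compose[OF scott_continuous_snd assms(2)]]
  by (simp add: map_prod_def case_prod_beta')

lemma scott_continuous_assoc:
  "scott_continuous ((D \<times>\<^sub>D E) \<times>\<^sub>D F) (D \<times>\<^sub>D (E \<times>\<^sub>D F)) (\<lambda>((x, y), z). (x, (y, z)))"
proof -
  have "scott_continuous ((D \<times>\<^sub>D E) \<times>\<^sub>D F) (D \<times>\<^sub>D (E \<times>\<^sub>D F)) (\<lambda>p. (fst (fst p), (snd (fst p), snd p)))"
    by (intro scott_continuous_prodI scott_continuous_snd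
        scott_continuous_compose[OF scott_continuous_fst scott_continuous_fst]
        scott_continuous_compose[OF scott_continuous_fst scott_continuous_snd])
  then show ?thesis by (simp add: case_prod_beta')
qed

lemma scott_continuous_costrength:
  assumes po: "partial_order D" "partial_order E"
  shows "scott_continuous (\<M> D \<times>\<^sub>D E) (\<M> (D \<times>\<^sub>D E)) (costrength D E)"
proof -
  have "scott_continuous (\<M> D \<times>\<^sub>D E) (\<M> (D \<times>\<^sub>D E))
      (\<lambda>p. fmap (E \<times>\<^sub>D D) (D \<times>\<^sub>D E) prod.swap (strength E D (prod.swap p)))"
    using po partial_order_M
    by (intro scott_continuous_compose[OF scott_continuous_compose[OF scott_continuous_swap scott_continuous_strength]
        scott_continuous_fmap[OF _ _ scott_continuous_swap]] partial_order_prod)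
  then show ?thesis by (simp add: costrength_def case_prod_beta' prod.swap_def)
qed

lemma costrength_M:
  assumes "partial_order D" "partial_order E" "\<nu> \<in> carrier (\<M> D)" "b \<in> carrier E"
  shows "costrength D E (\<nu>, b) \<in> carrier (\<M> (D \<times>\<^sub>D E))"
  using scott_continuous_costrength[OF assms(1,2)] assms(3,4) by (auto simp: scott_continuous_def)

lemma vintegral_costrength:
  assumes po: "partial_order D" "partial_order E" and "\<nu> \<in> carrier (\<M> D)" "b \<in> carrier E" "scont (D \<times>\<^sub>D E) h"
  shows "vintegral (D \<times>\<^sub>D E) (costrength D E (\<nu>, b)) h = vintegral D \<nu> (\<lambda>x. h (x, b))"
proof -
  have sw: "scott_continuous (E \<times>\<^sub>D D) (D \<times>\<^sub>D E) prod.swap" by (rule scott_continuous_swap)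
  have "vintegral (D \<times>\<^sub>D E) (costrength D E (\<nu>, b)) h =
      vintegral (E \<times>\<^sub>D D) (strength E D (b, \<nu>)) (\<lambda>p. h (prod.swap p))"
    unfolding costrength_def split
    by (intro vintegral_fmap partial_order_prod po sw strength_M assms(3-))
  also have "\<dots> = vintegral D \<nu> (\<lambda>x. h (prod.swap (b, x)))"
    by (intro vintegral_strength po assms(3,4) scott_continuous_compose[OF sw assms(5)])
  finally show ?thesis by simp
qed

text \<open>Both iterated integrals are Scott-continuous in \<open>\<nu>\<close>, so it suffices to consider simple \<open>\<nu>\<close>,
  for which the claim is the linearity of integration against \<open>\<xi>\<close>.\<close>

lemma vintegral_fubini:
  assumes po: "partial_order D" "partial_order E" and f: "scont (D \<times>\<^sub>D E) f"
    and \<nu>: "\<nu> \<in> carrier (\<M> D)" and \<xi>: "\<xi> \<in> carrier (\<M> E)"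
  shows "vintegral D \<nu> (\<lambda>x. vintegral E \<xi> (\<lambda>y. f (x, y))) = vintegral E \<xi> (\<lambda>y. vintegral D \<nu> (\<lambda>x. f (x, y)))"
  using \<nu>
proof (rule M_scont_eq)
  note s1 = scont_slice1[OF po(2) f]
  have sc: "scont D (\<lambda>x. vintegral E \<xi> (\<lambda>y. f (x, y)))"
    by (rule scont_vintegral_slice[OF po f M_in_V[OF \<xi>]])
  then show "scont (\<M> D) (\<lambda>\<nu>. vintegral D \<nu> (\<lambda>x. vintegral E \<xi> (\<lambda>y. f (x, y))))"
    by (rule scont_vintegral)
  \<comment> \<open>On the other side of the equation \<nu> sits in the inner integral. Joint
    continuity in \<nu> and \<open>y\<close>, obtained by exchanging the factors, allows the
    integration over \<open>y\<close> with \<nu> as parameter.\<close>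
  have "scont (\<M> D \<times>\<^sub>D E) (\<lambda>p. vintegral D (fst p) (\<lambda>x. f (x, snd p)))"
    using scott_continuous_compose[OF scott_continuous_swap
        scont_vintegral_joint[OF po(2,1) scott_continuous_compose[OF scott_continuous_swap f]]]
    by simp
  from scont_vintegral_slice[OF partial_order_M po(2) this M_in_V[OF \<xi>]]
  show "scont (\<M> D) (\<lambda>\<nu>. vintegral E \<xi> (\<lambda>y. vintegral D \<nu> (\<lambda>x. f (x, y))))" by simp
  fix \<nu> assume "\<nu> \<in> \<S> D"
  then obtain n :: nat and r x where \<nu>: "\<nu> = wsum D {1..n} r (\<lambda>i. dirac D (x i))"
    "\<And>i. i \<in> {1..n} \<Longrightarrow> 0 \<le> r i" "\<And>i. i \<in> {1..n} \<Longrightarrow> x i \<in> carrier D" "sum r {1..n} \<le> 1"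
    by (metis S_wsumE)
  have "vintegral D \<nu> (\<lambda>x. vintegral E \<xi> (\<lambda>y. f (x, y))) = (\<Sum>i=1..n. r i * vintegral E \<xi> (\<lambda>y. f (x i, y)))"
    unfolding \<nu>(1) using vintegral_wsum_dirac[OF finite_atLeastAtMost \<nu>(3) sc, where r = r] by simp
  also have "\<dots> = vintegral E \<xi> (\<lambda>y. \<Sum>i=1..n. r i * f (x i, y))"
    by (rule vintegral_sum[OF po(2) \<xi> _ \<nu>(2,4) scont_slice2[OF po(1) f \<nu>(3)], symmetric]) simp_all
  also have "\<dots> = vintegral E \<xi> (\<lambda>y. vintegral D \<nu> (\<lambda>x. f (x, y)))"
    unfolding \<nu>(1) using vintegral_wsum_dirac[OF finite_atLeastAtMost \<nu>(3) s1, where r = r] by (intro vintegral_cong) simp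
  finally show "vintegral D \<nu> (\<lambda>x. vintegral E \<xi> (\<lambda>y. f (x, y))) = vintegral E \<xi> (\<lambda>y. vintegral D \<nu> (\<lambda>x. f (x, y)))" .
qed

section \<open>The laws of a commutative strong monad\<close>

lemma partial_order_one: "partial_order one_order"
  by (rule partial_orderI) (auto simp: one_order_def)

theorem theorem3p3:
  fixes D :: "'a gorder" and E :: "'b gorder" and F :: "'c gorder" and G :: "'d gorder"
  assumes "dcpo D" and "dcpo E" and "dcpo F" and "dcpo G"
  shows
    "dcpo (\<M> D) \<and>
     scott_continuous D (\<M> D) (dirac D) \<and>
     (\<forall>f. scott_continuous D (\<M> E) f \<longrightarrow> scott_continuous (\<M> D) (\<M> E) (kleisli D E f)) \<and>
     scott_continuous (D \<times>\<^sub>D \<M> E) (\<M> (D \<times>\<^sub>D E)) (strength D E) \<and>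
     \<comment> \<open>monad laws\<close>
     (\<forall>\<nu>\<in>carrier (\<M> D). kleisli D D (dirac D) \<nu> = \<nu>) \<and>
     (\<forall>f. scott_continuous D (\<M> E) f \<longrightarrow> (\<forall>x\<in>carrier D. kleisli D E f (dirac D x) = f x)) \<and>
     (\<forall>f g. scott_continuous D (\<M> E) f \<and> scott_continuous E (\<M> F) g \<longrightarrow>
        (\<forall>\<nu>\<in>carrier (\<M> D).
           kleisli D F (\<lambda>x. kleisli E F g (f x)) \<nu> = kleisli E F g (kleisli D E f \<nu>))) \<and>
     \<comment> \<open>naturality of the strength\<close>
     (\<forall>h k. scott_continuous D F h \<and> scott_continuous E G k \<longrightarrow>
        (\<forall>a\<in>carrier D. \<forall>\<nu>\<in>carrier (\<M> E).
           fmap (D \<times>\<^sub>D E) (F \<times>\<^sub>D G) (map_prod h k) (strength D E (a, \<nu>)) =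
           strength F G (h a, fmap E G k \<nu>))) \<and>
     \<comment> \<open>compatibility of the strength with the unitor, the associator, unit and multiplication\<close>
     (\<forall>\<nu>\<in>carrier (\<M> D).
        fmap (one_order \<times>\<^sub>D D) D snd (strength one_order D ((), \<nu>)) = \<nu>) \<and>
     (\<forall>a\<in>carrier D. \<forall>b\<in>carrier E. \<forall>\<nu>\<in>carrier (\<M> F).
        fmap ((D \<times>\<^sub>D E) \<times>\<^sub>D F) (D \<times>\<^sub>D (E \<times>\<^sub>D F)) (\<lambda>((x, y), z). (x, (y, z)))
          (strength (D \<times>\<^sub>D E) F ((a, b), \<nu>)) =
        strength D (E \<times>\<^sub>D F) (a, strength E F (b, \<nu>))) \<and>
     (\<forall>a\<in>carrier D. \<forall>b\<in>carrier E. strength D E (a, dirac E b) = dirac (D \<times>\<^sub>D E) (a, b)) \<and>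
     (\<forall>a\<in>carrier D. \<forall>\<Phi>\<in>carrier (\<M> (\<M> E)).
        strength D E (a, kl_mult E \<Phi>) =
        kl_mult (D \<times>\<^sub>D E)
          (fmap (D \<times>\<^sub>D \<M> E) (\<M> (D \<times>\<^sub>D E)) (strength D E) (strength D (\<M> E) (a, \<Phi>)))) \<and>
     \<comment> \<open>commutativity, as equality of the two double strengths and as the Fubini equation\<close>
     (\<forall>\<nu>\<in>carrier (\<M> D). \<forall>\<xi>\<in>carrier (\<M> E).
        kleisli (\<M> D \<times>\<^sub>D E) (D \<times>\<^sub>D E) (costrength D E) (strength (\<M> D) E (\<nu>, \<xi>)) =
        kleisli (D \<times>\<^sub>D \<M> E) (D \<times>\<^sub>D E) (strength D E) (costrength D (\<M> E) (\<nu>, \<xi>))) \<and>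
     (\<forall>U. openin (scott_topology (D \<times>\<^sub>D E)) U \<longrightarrow>
        (\<forall>\<nu>\<in>carrier (\<M> D). \<forall>\<xi>\<in>carrier (\<M> E).
           vintegral D \<nu> (\<lambda>x. vintegral E \<xi> (\<lambda>y. indicator U (x, y))) =
           vintegral E \<xi> (\<lambda>y. vintegral D \<nu> (\<lambda>x. indicator U (x, y)))))"
proof (intro conjI allI impI ballI)
  have po: "partial_order D" "partial_order E" "partial_order F" "partial_order G"
    using assms by (simp_all add: dcpo_def)
  note poP = partial_order_prod and poM = partial_order_M
  show "dcpo (\<M> D)" by (rule dcpo_M)
  show "scott_continuous D (\<M> D) (dirac D)" by (intro scott_continuous_dirac po)
  show "scott_continuous (\<M> D) (\<M> E) (kleisli D E f)" if "scott_continuous D (\<M> E) f" for f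
    by (intro scott_continuous_kleisli po that)
  show "scott_continuous (D \<times>\<^sub>D \<M> E) (\<M> (D \<times>\<^sub>D E)) (strength D E)"
    by (intro scott_continuous_strength po)
  show "kleisli D D (dirac D) \<nu> = \<nu>" if \<nu>: "\<nu> \<in> carrier (\<M> D)" for \<nu>
  proof (rule M_eqI)
    fix h assume h: "scont D h"
    show "vintegral D (kleisli D D (dirac D) \<nu>) h = vintegral D \<nu> h"
      using vintegral_kleisli[OF po(1) scott_continuous_dirac[OF po(1)] \<nu> h]
      by (simp cong: vintegral_cong add: vintegral_dirac h)
  qed (intro kleisli_M po scott_continuous_dirac \<nu>)+
  \<comment> \<open>No test function is needed here: at an open \<open>U\<close> the left side
    integrates \<open>f x U\<close> against a Dirac valuation.\<close>
  show "kleisli D E f (dirac D x) = f x" if f: "scott_continuous D (\<M> E) f" and x: "x \<in> carrier D" for f x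
  proof (rule V_eqI)
    show "kleisli D E f (dirac D x) \<in> carrier (\<V> E)"
      by (intro M_in_V kleisli_M po f dirac_M x)
    show "f x \<in> carrier (\<V> E)" using f x by (auto simp: scott_continuous_def intro: M_in_V)
  qed (simp add: kleisli_apply vintegral_dirac[OF x] scont_apply[OF po(1) f])
  \<comment> \<open>Paired with \<open>h\<close>, both sides become the threefold iterated integral
    of \<open>h\<close> against \<open>g y\<close>, then \<open>f x\<close>, then \<nu>.\<close>
  show "kleisli D F (\<lambda>x. kleisli E F g (f x)) \<nu> = kleisli E F g (kleisli D E f \<nu>)"
    if fg: "scott_continuous D (\<M> E) f \<and> scott_continuous E (\<M> F) g" and \<nu>: "\<nu> \<in> carrier (\<M> D)" for f g \<nu>
  proof -
    have f: "scott_continuous D (\<M> E) f" and g: "scott_continuous E (\<M> F) g" using fg by auto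
    have fx: "f x \<in> carrier (\<M> E)" if "x \<in> carrier D" for x using f that by (auto simp: scott_continuous_def)
    note gf = scott_continuous_compose[OF f scott_continuous_kleisli[OF po(2) g]]
    show ?thesis
    proof (rule M_eqI)
      show "kleisli D F (\<lambda>x. kleisli E F g (f x)) \<nu> \<in> carrier (\<M> F)" by (intro kleisli_M po gf \<nu>)
      show "kleisli E F g (kleisli D E f \<nu>) \<in> carrier (\<M> F)" by (intro kleisli_M po f g \<nu>)
      fix h assume h: "scont F h"
      have "vintegral F (kleisli D F (\<lambda>x. kleisli E F g (f x)) \<nu>) h =
          vintegral D \<nu> (\<lambda>x. vintegral F (kleisli E F g (f x)) h)"
        by (rule vintegral_kleisli[OF po(1) gf \<nu> h])
      also have "\<dots> = vintegral D \<nu> (\<lambda>x. vintegral E (f x) (\<lambda>y. vintegral F (g y) h))"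
        by (intro vintegral_cong vintegral_kleisli[OF po(2) g fx h])
      also have "\<dots> = vintegral E (kleisli D E f \<nu>) (\<lambda>y. vintegral F (g y) h)"
        by (rule vintegral_kleisli[OF po(1) f \<nu> scott_continuous_compose[OF g scont_vintegral[OF h]], symmetric])
      also have "\<dots> = vintegral F (kleisli E F g (kleisli D E f \<nu>)) h"
        by (rule vintegral_kleisli[OF po(2) g kleisli_M[OF po(1) f \<nu>] h, symmetric])
      finally show "vintegral F (kleisli D F (\<lambda>x. kleisli E F g (f x)) \<nu>) h =
          vintegral F (kleisli E F g (kleisli D E f \<nu>)) h" .
    qed
  qed
  \<comment> \<open>Both sides integrate a test function \<open>u\<close> to the integral of
    \<open>u (h a, k y)\<close> against \<nu>.\<close>
  show "fmap (D \<times>\<^sub>D E) (F \<times>\<^sub>D G) (map_prod h k) (strength D E (a, \<nu>)) = strength F G (h a, fmap E G k \<nu>)"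
    if hk: "scott_continuous D F h \<and> scott_continuous E G k" and a: "a \<in> carrier D" and \<nu>: "\<nu> \<in> carrier (\<M> E)"
    for h k a \<nu>
  proof -
    have h: "scott_continuous D F h" and k: "scott_continuous E G k" using hk by auto
    have ha: "h a \<in> carrier F" using h a by (auto simp: scott_continuous_def)
    note hk' = scott_continuous_map_prod[OF h k]
    note kM = fmap_M[OF po(2,4) k \<nu>] and sM = strength_M[OF po(1,2) a \<nu>]
    show ?thesis
    proof (rule M_eqI)
      show "fmap (D \<times>\<^sub>D E) (F \<times>\<^sub>D G) (map_prod h k) (strength D E (a, \<nu>)) \<in> carrier (\<M> (F \<times>\<^sub>D G))"
        by (intro fmap_M poP po hk' sM)
      show "strength F G (h a, fmap E G k \<nu>) \<in> carrier (\<M> (F \<times>\<^sub>D G))"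
        by (intro strength_M po ha kM)
      fix u assume u: "scont (F \<times>\<^sub>D G) u"
      show "vintegral (F \<times>\<^sub>D G) (fmap (D \<times>\<^sub>D E) (F \<times>\<^sub>D G) (map_prod h k) (strength D E (a, \<nu>))) u =
          vintegral (F \<times>\<^sub>D G) (strength F G (h a, fmap E G k \<nu>)) u"
        by (simp add: vintegral_fmap[OF poP poP] po hk' sM u vintegral_strength a \<nu> ha kM
            scott_continuous_compose[OF hk' u] vintegral_fmap[OF po(2,4) k \<nu>] scont_slice2[OF po(3) u ha])
    qed
  qed
  show "fmap (one_order \<times>\<^sub>D D) D snd (strength one_order D ((), \<nu>)) = \<nu>" if \<nu>: "\<nu> \<in> carrier (\<M> D)" for \<nu>
  proof -
    note snd' = scott_continuous_snd[of one_order D]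
    have u: "() \<in> carrier one_order" by (simp add: one_order_def)
    note sM = strength_M[OF partial_order_one po(1) u \<nu>]
    show ?thesis
    proof (rule M_eqI)
      show "fmap (one_order \<times>\<^sub>D D) D snd (strength one_order D ((), \<nu>)) \<in> carrier (\<M> D)"
        by (intro fmap_M poP po partial_order_one snd' sM)
      fix h assume h: "scont D h"
      show "vintegral D (fmap (one_order \<times>\<^sub>D D) D snd (strength one_order D ((), \<nu>))) h = vintegral D \<nu> h"
        by (simp add: vintegral_fmap[OF poP] partial_order_one po snd' sM h vintegral_strength u \<nu>
            scott_continuous_compose[OF snd' h])
    qed (rule \<nu>)
  qed
  \<comment> \<open>The common value on a test function is the integral of
    \<open>h (a, (b, y))\<close> against \<nu>.\<close>
  show "fmap ((D \<times>\<^sub>D E) \<times>\<^sub>D F) (D \<times>\<^sub>D (E \<times>\<^sub>D F)) (\<lambda>((x, y), z). (x, (y, z))) (strength (D \<times>\<^sub>D E) F ((a, b), \<nu>)) =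
      strength D (E \<times>\<^sub>D F) (a, strength E F (b, \<nu>))"
    if a: "a \<in> carrier D" and b: "b \<in> carrier E" and \<nu>: "\<nu> \<in> carrier (\<M> F)" for a b \<nu>
  proof -
    note as = scott_continuous_assoc[of D E F]
    note poDE = poP[OF po(1,2)] and poEF = poP[OF po(2,3)]
    have ab: "(a, b) \<in> carrier (D \<times>\<^sub>D E)" using a b by simp
    note s1 = strength_M[OF poDE po(3) ab \<nu>] and s2 = strength_M[OF po(2,3) b \<nu>]
    show ?thesis
    proof (rule M_eqI)
      show "fmap ((D \<times>\<^sub>D E) \<times>\<^sub>D F) (D \<times>\<^sub>D (E \<times>\<^sub>D F)) (\<lambda>((x, y), z). (x, (y, z))) (strength (D \<times>\<^sub>D E) F ((a, b), \<nu>))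
          \<in> carrier (\<M> (D \<times>\<^sub>D (E \<times>\<^sub>D F)))"
        by (rule fmap_M[OF poP[OF poDE po(3)] poP[OF po(1) poEF] as s1])
      show "strength D (E \<times>\<^sub>D F) (a, strength E F (b, \<nu>)) \<in> carrier (\<M> (D \<times>\<^sub>D (E \<times>\<^sub>D F)))"
        by (rule strength_M[OF po(1) poEF a s2])
      fix h assume h: "scont (D \<times>\<^sub>D (E \<times>\<^sub>D F)) h"
      show "vintegral (D \<times>\<^sub>D (E \<times>\<^sub>D F)) (fmap ((D \<times>\<^sub>D E) \<times>\<^sub>D F) (D \<times>\<^sub>D (E \<times>\<^sub>D F)) (\<lambda>((x, y), z). (x, (y, z))) (strength (D \<times>\<^sub>D E) F ((a, b), \<nu>))) h =
          vintegral (D \<times>\<^sub>D (E \<times>\<^sub>D F)) (strength D (E \<times>\<^sub>D F) (a, strength E F (b, \<nu>))) h"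
        unfolding vintegral_fmap[OF poP[OF poDE po(3)] poP[OF po(1) poEF] as s1 h]
          vintegral_strength[OF poDE po(3) ab \<nu> scott_continuous_compose[OF as h]]
          vintegral_strength[OF po(1) poEF a s2 h]
          vintegral_strength[OF po(2,3) b \<nu> scont_slice2[OF po(1) h a]]
        by simp
    qed
  qed
  show "strength D E (a, dirac E b) = dirac (D \<times>\<^sub>D E) (a, b)" if a: "a \<in> carrier D" and b: "b \<in> carrier E" for a b
  proof (rule M_eqI)
    have ab: "(a, b) \<in> carrier (D \<times>\<^sub>D E)" using a b by simp
    show "strength D E (a, dirac E b) \<in> carrier (\<M> (D \<times>\<^sub>D E))" by (intro strength_M po a dirac_M b)
    show "dirac (D \<times>\<^sub>D E) (a, b) \<in> carrier (\<M> (D \<times>\<^sub>D E))" by (rule dirac_M[OF ab])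
    fix h assume h: "scont (D \<times>\<^sub>D E) h"
    show "vintegral (D \<times>\<^sub>D E) (strength D E (a, dirac E b)) h = vintegral (D \<times>\<^sub>D E) (dirac (D \<times>\<^sub>D E) (a, b)) h"
      by (simp only: vintegral_strength[OF po(1,2) a dirac_M[OF b] h] vintegral_dirac[OF ab h]
          vintegral_dirac[OF b scont_slice2[OF po(1) h a]])
  qed
  \<comment> \<open>Both sides reduce to integrating \<open>h (a, y)\<close> against \<nu>, and the
    result against \<Phi> as a function of \<nu>.\<close>
  show "strength D E (a, kl_mult E \<Phi>) =
      kl_mult (D \<times>\<^sub>D E) (fmap (D \<times>\<^sub>D \<M> E) (\<M> (D \<times>\<^sub>D E)) (strength D E) (strength D (\<M> E) (a, \<Phi>)))"
    if a: "a \<in> carrier D" and \<Phi>: "\<Phi> \<in> carrier (\<M> (\<M> E))" for a \<Phi>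
  proof -
    note str = scott_continuous_strength[OF po(1,2)]
    note poDM = poP[OF po(1) poM[of E]]
    note sM = strength_M[OF po(1) poM a \<Phi>]
    note fM = fmap_M[OF poDM poM str sM]
    note kM = kl_mult_M[OF \<Phi>]
    show ?thesis
    proof (rule M_eqI)
      show "strength D E (a, kl_mult E \<Phi>) \<in> carrier (\<M> (D \<times>\<^sub>D E))" by (intro strength_M po a kM)
      show "kl_mult (D \<times>\<^sub>D E) (fmap (D \<times>\<^sub>D \<M> E) (\<M> (D \<times>\<^sub>D E)) (strength D E) (strength D (\<M> E) (a, \<Phi>)))
          \<in> carrier (\<M> (D \<times>\<^sub>D E))" by (rule kl_mult_M[OF fM])
      fix h assume h: "scont (D \<times>\<^sub>D E) h"
      have "vintegral (D \<times>\<^sub>D E) (strength D E (a, kl_mult E \<Phi>)) h =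
          vintegral (\<M> E) \<Phi> (\<lambda>\<nu>. vintegral E \<nu> (\<lambda>y. h (a, y)))"
        by (simp only: vintegral_strength[OF po(1,2) a kM h] vintegral_kl_mult[OF \<Phi> scont_slice2[OF po(1) h a]])
      also have "\<dots> = vintegral (\<M> E) \<Phi> (\<lambda>\<nu>. vintegral (D \<times>\<^sub>D E) (strength D E (a, \<nu>)) h)"
        by (intro vintegral_cong vintegral_strength[OF po(1,2) a _ h, symmetric])
      also have "\<dots> = vintegral (D \<times>\<^sub>D E)
          (kl_mult (D \<times>\<^sub>D E) (fmap (D \<times>\<^sub>D \<M> E) (\<M> (D \<times>\<^sub>D E)) (strength D E) (strength D (\<M> E) (a, \<Phi>)))) h"
        by (simp only: vintegral_kl_mult[OF fM h] vintegral_fmap[OF poDM poM str sM scont_vintegral[OF h]]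
            vintegral_strength[OF po(1) poM a \<Phi> scott_continuous_compose[OF str scont_vintegral[OF h]]])
      finally show "vintegral (D \<times>\<^sub>D E) (strength D E (a, kl_mult E \<Phi>)) h = vintegral (D \<times>\<^sub>D E)
          (kl_mult (D \<times>\<^sub>D E) (fmap (D \<times>\<^sub>D \<M> E) (\<M> (D \<times>\<^sub>D E)) (strength D E) (strength D (\<M> E) (a, \<Phi>)))) h" .
    qed
  qed
  \<comment> \<open>The two double strengths pair with \<open>h\<close> to the two iterated
    integrals of \<open>h\<close>, so their equality is Fubini for all Scott-continuous
    \<open>h\<close>.\<close>
  show "kleisli (\<M> D \<times>\<^sub>D E) (D \<times>\<^sub>D E) (costrength D E) (strength (\<M> D) E (\<nu>, \<xi>)) =
      kleisli (D \<times>\<^sub>D \<M> E) (D \<times>\<^sub>D E) (strength D E) (costrength D (\<M> E) (\<nu>, \<xi>))"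
    if \<nu>: "\<nu> \<in> carrier (\<M> D)" and \<xi>: "\<xi> \<in> carrier (\<M> E)" for \<nu> \<xi>
  proof -
    note str = scott_continuous_strength[OF po(1,2)] and cos = scott_continuous_costrength[OF po(1,2)]
    note poME = poP[OF poM[of D] po(2)] and poDM = poP[OF po(1) poM[of E]]
    note sM = strength_M[OF poM po(2) \<nu> \<xi>] and cM = costrength_M[OF po(1) poM \<nu> \<xi>]
    show ?thesis
    proof (rule M_eqI[OF kleisli_M[OF poME cos sM] kleisli_M[OF poDM str cM]])
      fix h assume h: "scont (D \<times>\<^sub>D E) h"
      note hs = scott_continuous_compose[OF str scont_vintegral[OF h]]
        and hc = scott_continuous_compose[OF cos scont_vintegral[OF h]]
      have "vintegral (D \<times>\<^sub>D E) (kleisli (\<M> D \<times>\<^sub>D E) (D \<times>\<^sub>D E) (costrength D E) (strength (\<M> D) E (\<nu>, \<xi>))) h =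
          vintegral E \<xi> (\<lambda>y. vintegral (D \<times>\<^sub>D E) (costrength D E (\<nu>, y)) h)"
        by (simp only: vintegral_kleisli[OF poME cos sM h] vintegral_strength[OF poM po(2) \<nu> \<xi> hc])
      also have "\<dots> = vintegral E \<xi> (\<lambda>y. vintegral D \<nu> (\<lambda>x. h (x, y)))"
        by (intro vintegral_cong vintegral_costrength po \<nu> h)
      also have "\<dots> = vintegral D \<nu> (\<lambda>x. vintegral E \<xi> (\<lambda>y. h (x, y)))"
        by (rule vintegral_fubini[OF po(1,2) h \<nu> \<xi>, symmetric])
      also have "\<dots> = vintegral D \<nu> (\<lambda>x. vintegral (D \<times>\<^sub>D E) (strength D E (x, \<xi>)) h)"
        by (intro vintegral_cong vintegral_strength[symmetric] po \<xi> h)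
      also have "\<dots> = vintegral (D \<times>\<^sub>D E) (kleisli (D \<times>\<^sub>D \<M> E) (D \<times>\<^sub>D E) (strength D E) (costrength D (\<M> E) (\<nu>, \<xi>))) h"
        by (simp only: vintegral_kleisli[OF poDM str cM h] vintegral_costrength[OF po(1) poM \<nu> \<xi> hs])
      finally show "vintegral (D \<times>\<^sub>D E) (kleisli (\<M> D \<times>\<^sub>D E) (D \<times>\<^sub>D E) (costrength D E) (strength (\<M> D) E (\<nu>, \<xi>))) h =
          vintegral (D \<times>\<^sub>D E) (kleisli (D \<times>\<^sub>D \<M> E) (D \<times>\<^sub>D E) (strength D E) (costrength D (\<M> E) (\<nu>, \<xi>))) h" .
    qed
  qed
  show "vintegral D \<nu> (\<lambda>x. vintegral E \<xi> (\<lambda>y. indicator U (x, y))) =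
      vintegral E \<xi> (\<lambda>y. vintegral D \<nu> (\<lambda>x. indicator U (x, y)))"
    if U: "openin (scott_topology (D \<times>\<^sub>D E)) U" and \<nu>: "\<nu> \<in> carrier (\<M> D)" and \<xi>: "\<xi> \<in> carrier (\<M> E)" for U \<nu> \<xi>
    using U by (intro vintegral_fubini po \<nu> \<xi> scont_indicator) simp
qed

end
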